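(* Let $\rho\in\mathbb{R}$ and $t>0$. The sojourn time $\mathbf{T}_t$ has a density on $(0,t)$, given for $0<s<t$ by $$\mathbb{P}\{\mathbf{T}_t\in ds\}/ds=\begin{cases}\displaystyle\frac{1}{\sqrt{2\pi}}\bigg[\rho+\frac{1}{2\sqrt{2\pi}}\int_s^{\infty}\frac{e^{-\rho^2z/2}}{z^{3/2}}\,dz\bigg]\int_{t-s}^{\infty}\frac{e^{-\rho^2z/2}}{z^{3/2}}\,dz&\text{if }\rho\ge0,\\[3ex] \displaystyle\frac{1}{\sqrt{2\pi}}\bigg[|\rho|+\frac{1}{2\sqrt{2\pi}}\int_{t-s}^{\infty}\frac{e^{-\rho^2z/2}}{z^{3/2}}\,dz\bigg]\int_{s}^{\infty}\frac{e^{-\rho^2z/2}}{z^{3/2}}\,dz&\text{if }\rho\le0.\end{cases}$$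
   Context: Let $(\tilde B_t)_{t\ge0}$ be a standard linear Brownian motion started at $0$ and let $B_t=\tilde B_t+\rho t$, $t\ge0$, be the Brownian motion with linear drift $\rho\in\mathbb{R}$. Its sojourn time in $\mathbb{R}^+=[0,+\infty)$ up to time $t$ is $\mathbf{T}_t=\int_0^t\mathbf{1}_{\mathbb{R}^+}(B_s)\,ds$. *)

theory Defs
  imports "HOL-Probability.Probability"
begin

text \<open>Standard linear Brownian motion started at 0. The time set is \<open>[0, \<infinity>)\<close>; values of \<open>B\<close> at
  negative times are irrelevant. All paths (not just almost all) are continuous, so that the
  sojourn time below is a random variable without completing \<open>M\<close>.\<close>

locale brownian_motion = prob_space M for M :: "'a measure" +
  fixes B :: "real \<Rightarrow> 'a \<Rightarrow> real"
  assumes random_variable: "0 \<le> t \<Longrightarrow> B t \<in> borel_measurable M"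
    and start: "AE \<omega> in M. B 0 \<omega> = 0"
    and indep_increments:
      "0 \<le> \<tau> 0 \<Longrightarrow> (\<And>i. i < n \<Longrightarrow> \<tau> i < \<tau> (Suc i)) \<Longrightarrow>
        indep_vars (\<lambda>_. borel) (\<lambda>i \<omega>. B (\<tau> (Suc i)) \<omega> - B (\<tau> i) \<omega>) {..<n::nat}"
    and normal_increments:
      "0 \<le> s \<Longrightarrow> s < t \<Longrightarrow>
        distributed M lborel (\<lambda>\<omega>. B t \<omega> - B s \<omega>) (normal_density 0 (sqrt (t - s)))"
    and continuous_paths: "\<omega> \<in> space M \<Longrightarrow> continuous_on {0..} (\<lambda>t. B t \<omega>)"

definition with_drift :: "(real \<Rightarrow> 'a \<Rightarrow> real) \<Rightarrow> real \<Rightarrow> real \<Rightarrow> 'a \<Rightarrow> real" where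
  "with_drift B \<rho> t \<omega> = B t \<omega> + \<rho> * t"

definition sojourn_time :: "(real \<Rightarrow> 'a \<Rightarrow> real) \<Rightarrow> real \<Rightarrow> 'a \<Rightarrow> real" where
  "sojourn_time X t \<omega> = (LBINT s:{0..t}. indicator {0..} (X s \<omega>))"

end

theory Submission
  imports Defs
begin

text \<open>Write \<open>X\<close> for the drifted motion and \<open>A\<^sub>t\<close> for its sojourn time. Since
  \<open>1 = exp (-\<mu> A\<^sub>t) + \<mu> \<integral>\<^sub>0\<^sup>t 1[X\<^sub>s \<ge> 0] exp (-\<mu> A\<^sub>s) ds\<close> and the weight \<open>exp (-\<mu> A\<^sub>s)\<close> depends only on the path
  up to time \<open>s\<close>, independence of the increment \<open>X\<^sub>t - X\<^sub>s\<close> from the past gives a linear equation for the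
  Laplace transform in \<open>t\<close> of \<open>E (exp (-\<mu> A\<^sub>t) f(X\<^sub>t))\<close>. An explicit \<open>f\<close> built from exponentials solves it:
  with \<open>\<gamma>\<^sup>2 = 2 \<kappa> + \<rho>\<^sup>2\<close> and \<open>\<delta>\<^sup>2 = 2 (\<kappa> + \<mu>) + \<rho>\<^sup>2\<close>, the double Laplace transform of the law of \<open>A\<^sub>t\<close> is
  \<open>2 / ((\<delta> - \<rho>) (\<gamma> + \<rho>))\<close>. This is a product of a function of \<open>\<kappa> + \<mu>\<close> and a function of \<open>\<kappa>\<close>, hence the
  transform of a convolution \<open>L(s) R(t - s)\<close>, and uniqueness of Laplace transforms in both variables
  identifies the density.\<close>

section \<open>Integrals on half-lines\<close>

text \<open>The linear equation is of forward type: it carries the weight of the past and restarts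
  only the free semigroup. Hence only the motion started at 0 enters, never a family of motions with
  arbitrary starting points. The two signs of \<rho> separate only at the end. As \<open>(\<delta> -
  \<rho>) * (\<delta> + \<rho>) = 2 * (\<kappa> + \<mu>)\<close> and
  \<open>(\<gamma> - \<rho>) * (\<gamma> + \<rho>) = 2 * \<kappa>\<close>, the double transform is
  \<open>(\<delta> + \<rho>) / (\<kappa> + \<mu>)\<close> times
  \<open>(\<gamma> - \<rho>) / (2 * \<kappa>)\<close>. A root minus |\<rho>| comes from a multiple
  of the tail integral, a root plus |\<rho>| from a constant plus such a multiple. The sign decides
  which of the two is attached to \<open>s\<close> and which to \<open>t - s\<close>. This costs
  nothing: uniqueness only asks for \<open>\<mu> = n\<close> and \<open>\<kappa> = n + 1 + m\<close>
  with natural \<open>n\<close> and \<open>m\<close>. All integrands being nonnegative, the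
  integrals are taken in \<open>ennreal\<close>, where Tonelli asks for measurability alone; the
  fundamental theorem of calculus is therefore restated for such integrals, with limits at the
  endpoints to allow singularities there.\<close>

lemma nn_integral_FTC_einterval:
  fixes f F :: "real \<Rightarrow> real" and a b :: ereal
  assumes "a < b"
    and F: "\<And>x. a < ereal x \<Longrightarrow> ereal x < b \<Longrightarrow> DERIV F x :> f x"
    and f: "\<And>x. a < ereal x \<Longrightarrow> ereal x < b \<Longrightarrow> isCont f x"
    and nonneg: "\<And>x. a < ereal x \<Longrightarrow> ereal x < b \<Longrightarrow> 0 \<le> f x"
    and A: "((F \<circ> real_of_ereal) \<longlongrightarrow> A) (at_right a)"
    and B: "((F \<circ> real_of_ereal) \<longlongrightarrow> B) (at_left b)"
  shows "(\<integral>\<^sup>+x. ennreal (indicator (einterval a b) x * f x) \<partial>lborel) = ennreal (B - A)"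
proof -
  have "AE x in lborel. a < ereal x \<longrightarrow> ereal x < b \<longrightarrow> 0 \<le> f x"
    using nonneg by (intro AE_I2) auto
  note FTC = interval_integral_FTC_nonneg[OF assms(1) F f this A B]
  have 1: "set_integrable lborel (einterval a b) f"
    by (rule FTC(1); assumption)
  have 2: "(LBINT x=a..b. f x) = B - A"
    by (rule FTC(2); assumption)
  have "(\<integral>\<^sup>+x. ennreal (indicator (einterval a b) x * f x) \<partial>lborel) = ennreal (\<integral>x. indicator (einterval a b) x * f x \<partial>lborel)"
    using 1 nonneg
    by (intro nn_integral_eq_integral) (auto simp: set_integrable_def einterval_def split: split_indicator)
  also have "(\<integral>x. indicator (einterval a b) x * f x \<partial>lborel) = B - A"
    using 2 assms(1) by (simp add: interval_lebesgue_integral_def set_lebesgue_integral_def less_imp_le)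
  finally show ?thesis .
qed

lemma nn_integral_FTC_greaterThan:
  fixes f F :: "real \<Rightarrow> real" and a :: real
  assumes "\<And>x. a < x \<Longrightarrow> DERIV F x :> f x" "\<And>x. a < x \<Longrightarrow> isCont f x" "\<And>x. a < x \<Longrightarrow> 0 \<le> f x"
    and "(F \<longlongrightarrow> A) (at_right a)" "(F \<longlongrightarrow> B) at_top"
  shows "(\<integral>\<^sup>+x. ennreal (indicator {a<..} x * f x) \<partial>lborel) = ennreal (B - A)"
proof -
  have "einterval (ereal a) \<infinity> = {a<..}" by (auto simp: einterval_def)
  then show ?thesis
    using assms nn_integral_FTC_einterval[of "ereal a" \<infinity> F f A B] by (simp add: ereal_tendsto_simps1)
qed

lemma nn_integral_FTC_lessThan:
  fixes f F :: "real \<Rightarrow> real" and b :: real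
  assumes "\<And>x. x < b \<Longrightarrow> DERIV F x :> f x" "\<And>x. x < b \<Longrightarrow> isCont f x" "\<And>x. x < b \<Longrightarrow> 0 \<le> f x"
    and "(F \<longlongrightarrow> A) at_bot" "(F \<longlongrightarrow> B) (at_left b)"
  shows "(\<integral>\<^sup>+x. ennreal (indicator {..<b} x * f x) \<partial>lborel) = ennreal (B - A)"
proof -
  have "einterval (-\<infinity>) (ereal b) = {..<b}" by (auto simp: einterval_def)
  then show ?thesis
    using assms nn_integral_FTC_einterval[of "-\<infinity>" "ereal b" F f A B] by (simp add: ereal_tendsto_simps1)
qed

lemma nn_integral_FTC_greaterThanLessThan:
  fixes f F :: "real \<Rightarrow> real" and a b :: real
  assumes "a < b"
    and "\<And>x. a < x \<Longrightarrow> x < b \<Longrightarrow> DERIV F x :> f x" "\<And>x. a < x \<Longrightarrow> x < b \<Longrightarrow> isCont f x" "\<And>x. a < x \<Longrightarrow> x < b \<Longrightarrow> 0 \<le> f x"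
    and "continuous_on {a..b} F"
  shows "(\<integral>\<^sup>+x. ennreal (indicator {a<..<b} x * f x) \<partial>lborel) = ennreal (F b - F a)"
proof -
  have "einterval (ereal a) (ereal b) = {a<..<b}" by (auto simp: einterval_def)
  then show ?thesis
    using assms nn_integral_FTC_einterval[of "ereal a" "ereal b" F f "F a" "F b"]
    by (simp add: ereal_tendsto_simps1 continuous_on_Icc_at_leftD continuous_on_Icc_at_rightD)
qed

section \<open>Laplace integrals of powers and of the heat kernel\<close>

lemma nn_integral_exp_Ioo:
  fixes \<kappa> z :: real
  assumes "0 < \<kappa>" "0 < z"
  shows "(\<integral>\<^sup>+s. ennreal (indicator {0<..<z} s * exp (- \<kappa> * s)) \<partial>lborel) = ennreal ((1 - exp (- \<kappa> * z)) / \<kappa>)"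
proof -
  let ?F = "\<lambda>s. - exp (- \<kappa> * s) / \<kappa>"
  have "DERIV ?F s :> exp (- \<kappa> * s)" for s
    using assms by (auto intro!: derivative_eq_intros)
  then have "(\<integral>\<^sup>+s. ennreal (indicator {0<..<z} s * exp (- \<kappa> * s)) \<partial>lborel) = ennreal (?F z - ?F 0)"
    using assms
    by (intro nn_integral_FTC_greaterThanLessThan) (auto intro!: continuous_intros)
  then show ?thesis by (simp add: diff_divide_distrib)
qed

text \<open>The substitution \<open>t = c * z\<close> reduces this to the Gamma integral at 1/2,
  whose value is \<open>sqrt pi\<close>.\<close>

lemma nn_integral_exp_powr_half:
  fixes c :: real
  assumes "0 < c"
  shows "(\<integral>\<^sup>+z. ennreal (indicator {0<..} z * (exp (- c * z) / sqrt z)) \<partial>lborel) = ennreal (sqrt (pi / c))"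
proof -
  have "ennreal (sqrt pi) = (\<integral>\<^sup>+t. ennreal (indicator {0..} t * t powr (1/2 - 1) / exp t) \<partial>lborel)"
    using Gamma_conv_nn_integral_real[of "1/2"] by (simp add: Gamma_one_half_real)
  also have "\<dots> = (\<integral>\<^sup>+t. ennreal (indicator {0<..} t * (exp (- t) / sqrt t)) \<partial>lborel)"
    by (intro nn_integral_cong)
       (auto split: split_indicator simp: exp_minus powr_minus powr_half_sqrt field_simps)
  also have "\<dots> = c * (\<integral>\<^sup>+z. ennreal (indicator {0<..} (0 + c * z) * (exp (- (0 + c * z)) / sqrt (0 + c * z))) \<partial>lborel)"
    using assms by (subst nn_integral_real_affine[where c=c and t=0]) auto
  also have "\<dots> = c * (\<integral>\<^sup>+z. ennreal (1 / sqrt c) * ennreal (indicator {0<..} z * (exp (- c * z) / sqrt z)) \<partial>lborel)"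
    using assms
    by (intro arg_cong2[where f="(*)"] nn_integral_cong refl)
       (auto split: split_indicator simp: real_sqrt_mult zero_less_mult_iff ennreal_mult[symmetric])
  also have "\<dots> = ennreal (sqrt c) * (\<integral>\<^sup>+z. ennreal (indicator {0<..} z * (exp (- c * z) / sqrt z)) \<partial>lborel)"
    using assms by (subst nn_integral_cmult) (auto simp: mult.assoc[symmetric] ennreal_mult[symmetric] real_div_sqrt)
  finally have "ennreal (1 / sqrt c) * ennreal (sqrt pi) = ennreal (1 / sqrt c) * (ennreal (sqrt c) * (\<integral>\<^sup>+z. ennreal (indicator {0<..} z * (exp (- c * z) / sqrt z)) \<partial>lborel))"
    by simp
  then show ?thesis
    using assms by (simp add: mult.assoc[symmetric] ennreal_mult[symmetric] real_sqrt_divide)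
qed

text \<open>A Frullani argument: the difference of exponentials is the integral of
  \<open>z * exp (- c * z)\<close> over \<open>c\<close> between \<open>p\<close> and
  \<open>q\<close>. Exchanging the integrals leaves \<open>sqrt (pi / c)\<close>, with primitive
  \<open>2 * sqrt pi * sqrt c\<close>. Either exponential alone would diverge at 0. The value
  \<open>p = 0\<close> is included for the driftless case.\<close>

lemma nn_integral_exp_diff_powr:
  fixes p q :: real
  assumes "0 \<le> p" "p < q"
  shows "(\<integral>\<^sup>+z. ennreal (indicator {0<..} z * ((exp (- p * z) - exp (- q * z)) / z powr (3/2))) \<partial>lborel)
    = ennreal (2 * sqrt pi * (sqrt q - sqrt p))"
proof -
  have "(\<integral>\<^sup>+z. ennreal (indicator {0<..} z * ((exp (- p * z) - exp (- q * z)) / z powr (3/2))) \<partial>lborel)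
    = (\<integral>\<^sup>+z. \<integral>\<^sup>+c. ennreal (indicator {p<..<q} c * indicator {0<..} z * (exp (- c * z) / sqrt z)) \<partial>lborel \<partial>lborel)"
  proof (rule nn_integral_cong)
    fix z :: real
    show "ennreal (indicator {0<..} z * ((exp (- p * z) - exp (- q * z)) / z powr (3/2))) =
       (\<integral>\<^sup>+c. ennreal (indicator {p<..<q} c * indicator {0<..} z * (exp (- c * z) / sqrt z)) \<partial>lborel)"
    proof (cases "0 < z")
      case True
      let ?F = "\<lambda>c. - exp (- c * z) / (z * sqrt z)"
      have "DERIV ?F c :> exp (- c * z) / sqrt z" for c
        using True by (auto intro!: derivative_eq_intros)
      then have "(\<integral>\<^sup>+c. ennreal (indicator {p<..<q} c * (exp (- c * z) / sqrt z)) \<partial>lborel) = ennreal (?F q - ?F p)"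
        using assms True
        by (intro nn_integral_FTC_greaterThanLessThan) (auto intro!: continuous_intros)
      also have "z * sqrt z = z powr (3/2)"
        using True powr_add[of z 1 "1/2"] by (simp add: powr_half_sqrt)
      finally show ?thesis using True by (simp add: diff_divide_distrib)
    qed simp
  qed
  also have "\<dots> = (\<integral>\<^sup>+c. \<integral>\<^sup>+z. ennreal (indicator {p<..<q} c * indicator {0<..} z * (exp (- c * z) / sqrt z)) \<partial>lborel \<partial>lborel)"
    by (rule lborel_pair.Fubini') (measurable)
  also have "\<dots> = (\<integral>\<^sup>+c. ennreal (indicator {p<..<q} c * sqrt (pi / c)) \<partial>lborel)"
  proof (rule nn_integral_cong)
    fix c :: real
    show "(\<integral>\<^sup>+z. ennreal (indicator {p<..<q} c * indicator {0<..} z * (exp (- c * z) / sqrt z)) \<partial>lborel) = ennreal (indicator {p<..<q} c * sqrt (pi / c))"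
      using nn_integral_exp_powr_half[of c] assms by (cases "c \<in> {p<..<q}") auto
  qed
  also have "\<dots> = ennreal (2 * sqrt pi * sqrt q - 2 * sqrt pi * sqrt p)"
  proof (rule nn_integral_FTC_greaterThanLessThan)
    show "((\<lambda>c. 2 * sqrt pi * sqrt c) has_real_derivative sqrt (pi / c)) (at c)" if "p < c" "c < q" for c
      using that assms by (auto intro!: derivative_eq_intros simp: real_sqrt_divide field_simps)
  qed (use assms in \<open>auto intro!: continuous_intros\<close>)
  finally show ?thesis by (simp add: algebra_simps)
qed

text \<open>The distribution function is an integral over a half-line. Splitting it at
  \<open>a = x - 1\<close> leaves, near \<open>x\<close>, a constant plus an integral over a compact
  interval, to which the fundamental theorem of calculus applies.\<close>

lemma cdf_std_normal_DERIV: "(cdf std_normal_distribution has_real_derivative std_normal_density x) (at x)"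
proof -
  interpret N: real_distribution std_normal_distribution by (rule real_dist_normal_dist)
  have int: "set_integrable lborel S std_normal_density" if "S \<in> sets borel" for S
    unfolding set_integrable_def using that
    by (intro integrable_mult_indicator) (auto intro: integrable_normal_density)
  have cdf: "cdf std_normal_distribution y = (LBINT u:{..y}. std_normal_density u)" for y
  proof -
    have "emeasure std_normal_distribution {..y} = (\<integral>\<^sup>+u. ennreal (std_normal_density u * indicator {..y} u) \<partial>lborel)"
      by (subst emeasure_density) (auto intro!: nn_integral_cong split: split_indicator)
    also have "\<dots> = ennreal (LBINT u:{..y}. std_normal_density u)"
      unfolding set_lebesgue_integral_def
      using int[of "{..y}"] by (subst nn_integral_eq_integral) (auto simp: set_integrable_def mult.commute)
    finally show ?thesis
      unfolding cdf_def measure_def by (simp add: set_lebesgue_integral_def)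
  qed
  define a where "a = x - 1"
  have eq: "cdf std_normal_distribution y = cdf std_normal_distribution a + integral {a..y} std_normal_density"
    if "a \<le> y" for y
  proof -
    have "{..y} = {..a} \<union> {a<..y}" using that by auto
    then have "cdf std_normal_distribution y = (LBINT u:{..a}. std_normal_density u) + (LBINT u:{a<..y}. std_normal_density u)"
      unfolding cdf using set_integral_Un[OF _ int int, of "{..a}" "{a<..y}"] by (simp add: disjoint_iff)
    also have "(LBINT u:{a<..y}. std_normal_density u) = (LBINT u:{a..y}. std_normal_density u)"
      unfolding set_lebesgue_integral_def
      using AE_lborel_singleton[of a] by (intro integral_cong_AE) (auto split: split_indicator elim!: eventually_mono)
    also have "\<dots> = integral {a..y} std_normal_density"
      by (rule set_borel_integral_eq_integral(2)) (rule int, simp)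
    finally show ?thesis by (simp add: cdf)
  qed
  have "((\<lambda>y. integral {a..y} std_normal_density) has_real_derivative std_normal_density x) (at x within {a..x+1})"
    by (rule integral_has_real_derivative)
       (auto simp: a_def normal_density_def intro!: continuous_intros)
  then have "((\<lambda>y. integral {a..y} std_normal_density) has_real_derivative std_normal_density x) (at x within {a<..<x+1})"
    by (rule DERIV_subset) auto
  then have "((\<lambda>y. integral {a..y} std_normal_density) has_real_derivative std_normal_density x) (at x)"
    by (subst (asm) at_within_open) (auto simp: a_def)
  then have "((\<lambda>y. cdf std_normal_distribution a + integral {a..y} std_normal_density) has_real_derivative std_normal_density x) (at x)"
    by (auto intro!: derivative_eq_intros)
  then show ?thesis
  proof (rule has_field_derivative_transform_within_open[of _ _ _ "{a<..}"])
    show "cdf std_normal_distribution a + integral {a..y} std_normal_density = cdf std_normal_distribution y"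
      if "y \<in> {a<..}" for y
      using eq[of y] that by (simp only: greaterThan_iff less_imp_le)
  qed (simp_all add: a_def)
qed

text \<open>An explicit primitive in the time variable exists. At time 0 the two normal distribution
  functions in it tend to 0 and 1, at infinity both tend to 1, so that only the summand with
  \<open>exp (- \<gamma> * w)\<close> contributes to the difference.\<close>

lemma nn_integral_heat_kernel:
  fixes \<gamma> z :: real
  assumes "\<gamma> > 0" "z \<noteq> 0"
  shows "(\<integral>\<^sup>+r. ennreal (indicator {0<..} r * (exp (- z\<^sup>2 / (2 * r) - \<gamma>\<^sup>2 * r / 2) / sqrt (2 * pi * r))) \<partial>lborel)
    = ennreal (exp (- \<gamma> * \<bar>z\<bar>) / \<gamma>)"
proof -
  define w where "w = \<bar>z\<bar>"
  have w: "w > 0" "z\<^sup>2 = w\<^sup>2" using assms by (auto simp: w_def)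
  let ?P = "cdf std_normal_distribution"
  \<comment> \<open>the distribution function of the inverse Gaussian law, up to normalisation\<close>
  define F where "F r = (exp (- \<gamma> * w) * ?P (\<gamma> * sqrt r - w / sqrt r)
     + exp (\<gamma> * w) * ?P (\<gamma> * sqrt r + w / sqrt r)) / \<gamma>" for r
  define f where "f r = exp (- w\<^sup>2 / (2 * r) - \<gamma>\<^sup>2 * r / 2) / sqrt (2 * pi * r)" for r
  interpret N: real_distribution std_normal_distribution by (rule real_dist_normal_dist)
  \<comment> \<open>Completing the square: the prefactors \<open>exp (- \<gamma> * w)\<close> and
    \<open>exp (\<gamma> * w)\<close> absorb the cross terms, so both summands carry the same
    Gaussian factor. In the derivative of \<open>F\<close> the parts
    \<open>w / (2 * r * sqrt r)\<close> of the inner derivatives then cancel and the parts with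
    \<gamma> add up.\<close>
  have e1: "exp (- \<gamma> * w) * std_normal_density (\<gamma> * sqrt r - w / sqrt r) = exp (- w\<^sup>2 / (2 * r) - \<gamma>\<^sup>2 * r / 2) / sqrt (2 * pi)"
    and e2: "exp (\<gamma> * w) * std_normal_density (\<gamma> * sqrt r + w / sqrt r) = exp (- w\<^sup>2 / (2 * r) - \<gamma>\<^sup>2 * r / 2) / sqrt (2 * pi)" if "r > 0" for r
  proof -
    have "(\<gamma> * sqrt r - w / sqrt r)\<^sup>2 = \<gamma>\<^sup>2 * r - 2 * \<gamma> * w + w\<^sup>2 / r"
      "(\<gamma> * sqrt r + w / sqrt r)\<^sup>2 = \<gamma>\<^sup>2 * r + 2 * \<gamma> * w + w\<^sup>2 / r"
      using that by (auto simp: power2_eq_square field_simps)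
    then show "exp (- \<gamma> * w) * std_normal_density (\<gamma> * sqrt r - w / sqrt r) = exp (- w\<^sup>2 / (2 * r) - \<gamma>\<^sup>2 * r / 2) / sqrt (2 * pi)"
     "exp (\<gamma> * w) * std_normal_density (\<gamma> * sqrt r + w / sqrt r) = exp (- w\<^sup>2 / (2 * r) - \<gamma>\<^sup>2 * r / 2) / sqrt (2 * pi)"
      by (auto simp: normal_density_def exp_add[symmetric] field_simps)
  qed
  have D: "DERIV F r :> f r" if "r > 0" for r
  proof -
    let ?p = "\<gamma> * (inverse (sqrt r) / 2) + w / (2 * r * sqrt r)" and ?m = "\<gamma> * (inverse (sqrt r) / 2) - w / (2 * r * sqrt r)"
    have "DERIV F r :> (exp (- \<gamma> * w) * (std_normal_density (\<gamma> * sqrt r - w / sqrt r) * ?p)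
     + exp (\<gamma> * w) * (std_normal_density (\<gamma> * sqrt r + w / sqrt r) * ?m)) / \<gamma>"
      unfolding F_def using that assms(1)
      by (auto intro!: derivative_eq_intros DERIV_chain2[OF cdf_std_normal_DERIV] simp: field_simps)
    moreover have "(exp (- \<gamma> * w) * (std_normal_density (\<gamma> * sqrt r - w / sqrt r) * ?p)
     + exp (\<gamma> * w) * (std_normal_density (\<gamma> * sqrt r + w / sqrt r) * ?m)) / \<gamma> =
       ((exp (- \<gamma> * w) * std_normal_density (\<gamma> * sqrt r - w / sqrt r)) * ?p
     + (exp (\<gamma> * w) * std_normal_density (\<gamma> * sqrt r + w / sqrt r)) * ?m) / \<gamma>"
      by (simp only: mult.assoc)
    moreover have "\<dots> = f r"
      unfolding e1[OF that] e2[OF that] f_def using assms(1) that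
      by (simp add: field_simps real_sqrt_mult)
    ultimately show ?thesis by (simp only:)
  qed
  have cont: "isCont f r" if "r > 0" for r
    unfolding f_def using that by (auto intro!: continuous_intros)
  have F0: "(F \<longlongrightarrow> (exp (- \<gamma> * w) * 0 + exp (\<gamma> * w) * 1) / \<gamma>) (at_right 0)"
    unfolding F_def
  proof (intro tendsto_intros)
    have "filterlim (\<lambda>r. \<gamma> * sqrt r - w / sqrt r) at_bot (at_right 0)"
      "filterlim (\<lambda>r. \<gamma> * sqrt r + w / sqrt r) at_top (at_right 0)"
      using w assms by real_asymp+
    then show "((\<lambda>r. ?P (\<gamma> * sqrt r - w / sqrt r)) \<longlongrightarrow> 0) (at_right 0)"
      "((\<lambda>r. ?P (\<gamma> * sqrt r + w / sqrt r)) \<longlongrightarrow> 1) (at_right 0)"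
      by (auto intro: filterlim_compose[OF N.cdf_lim_at_bot] filterlim_compose[OF N.cdf_lim_at_top_prob])
  qed (use assms in auto)
  have F1: "(F \<longlongrightarrow> (exp (- \<gamma> * w) * 1 + exp (\<gamma> * w) * 1) / \<gamma>) at_top"
    unfolding F_def
  proof (intro tendsto_intros)
    have "filterlim (\<lambda>r. \<gamma> * sqrt r - w / sqrt r) at_top at_top"
      "filterlim (\<lambda>r. \<gamma> * sqrt r + w / sqrt r) at_top at_top"
      using w assms by real_asymp+
    then show "((\<lambda>r. ?P (\<gamma> * sqrt r - w / sqrt r)) \<longlongrightarrow> 1) at_top"
      "((\<lambda>r. ?P (\<gamma> * sqrt r + w / sqrt r)) \<longlongrightarrow> 1) at_top"
      by (auto intro: filterlim_compose[OF N.cdf_lim_at_top_prob])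
  qed (use assms in auto)
  have "(\<integral>\<^sup>+r. ennreal (indicator {0<..} r * f r) \<partial>lborel)
      = ennreal ((exp (- \<gamma> * w) * 1 + exp (\<gamma> * w) * 1) / \<gamma> - (exp (- \<gamma> * w) * 0 + exp (\<gamma> * w) * 1) / \<gamma>)"
    by (rule nn_integral_FTC_greaterThan[OF D cont _ F0 F1]) (simp_all add: f_def)
  also have "(exp (- \<gamma> * w) * 1 + exp (\<gamma> * w) * 1) / \<gamma> - (exp (- \<gamma> * w) * 0 + exp (\<gamma> * w) * 1) / \<gamma> = exp (- \<gamma> * w) / \<gamma>"
    by (simp add: add_divide_distrib)
  finally show ?thesis
    unfolding f_def w_def by simp
qed

section \<open>Uniqueness of Laplace transforms\<close>

text \<open>On [0, 1] all moments are at most 1, so the exponential series of the characteristic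
  function may be integrated term by term. The moments thus determine the characteristic function,
  and Levy's uniqueness theorem concludes.\<close>

lemma real_distribution_eqI_moments:
  fixes M N :: "real measure"
  assumes "real_distribution M" "real_distribution N"
    and M01: "AE x in M. x \<in> {0..1}" and N01: "AE x in N. x \<in> {0..1}"
    and moments: "\<And>n::nat. (\<integral>x. x ^ n \<partial>M) = (\<integral>x. x ^ n \<partial>N)"
  shows "M = N"
proof (rule Levy_uniqueness[OF assms(1,2)])
  have char: "(\<lambda>n. (\<i> * t) ^ n /\<^sub>R fact n * complex_of_real (\<integral>x. x ^ n \<partial>Q)) sums char Q t"
    if "real_distribution Q" and Q: "AE x in Q. x \<in> {0..1}" for Q and t :: real
  proof -
    interpret Q: real_distribution Q by fact
    let ?f = "\<lambda>n x. (\<i> * t) ^ n /\<^sub>R fact n * complex_of_real (x ^ n)"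
    have f: "?f n x = (\<i> * complex_of_real (t * x)) ^ n /\<^sub>R fact n" for n x
      by (simp add: power_mult_distrib scaleR_conv_of_real)
    have int_pow: "integrable Q (\<lambda>x. x ^ n)" for n :: nat
      by (rule Q.integrable_const_bound[of _ 1]) (rule eventually_mono[OF Q], auto intro!: power_le_one simp: power_abs)
    have int: "integrable Q (?f n)" for n
      using int_pow[of n] by (intro integrable_mult_right integrable_of_real)
    have nrm: "AE x in Q. norm (?f n x) \<le> \<bar>t\<bar> ^ n /\<^sub>R fact n" for n
      using Q
    proof eventually_elim
      case (elim x)
      then have "\<bar>x\<bar> ^ n \<le> 1" by (auto intro!: power_le_one)
      then show ?case
        by (auto simp: norm_mult norm_power power_abs field_simps mult_left_le)
    qed
    have "(\<lambda>n. \<integral>x. ?f n x \<partial>Q) sums (\<integral>x. (\<Sum>n. ?f n x) \<partial>Q)"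
    proof (rule sums_integral)
      show "AE x in Q. summable (\<lambda>n. norm (?f n x))"
        unfolding f by (intro always_eventually allI summable_norm_exp)
      show "summable (\<lambda>n. \<integral>x. norm (?f n x) \<partial>Q)"
      proof (rule summable_comparison_test')
        show "summable (\<lambda>n. \<bar>t\<bar> ^ n /\<^sub>R fact n)" by (rule summable_exp_generic)
        fix n :: nat
        have "(\<integral>x. norm (?f n x) \<partial>Q) \<le> (\<integral>x. \<bar>t\<bar> ^ n /\<^sub>R fact n \<partial>Q)"
          using nrm[of n] int[of n] by (intro integral_mono_AE integrable_norm) auto
        then show "norm (\<integral>x. norm (?f n x) \<partial>Q) \<le> \<bar>t\<bar> ^ n /\<^sub>R fact n"
          using Q.prob_space by simp
      qed
    qed (use int in auto)
    moreover have "(\<Sum>n. ?f n x) = iexp (t * x)" for x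
      unfolding f by (simp add: exp_def)
    moreover have "(\<integral>x. ?f n x \<partial>Q) = (\<i> * t) ^ n /\<^sub>R fact n * complex_of_real (\<integral>x. x ^ n \<partial>Q)" for n
      by (subst integral_mult_right_zero) (simp only: integral_complex_of_real)
    ultimately show ?thesis by (simp only: char_def)
  qed
  show "char M = char N"
  proof
    fix t
    from char[OF assms(1) M01, of t] char[OF assms(2) N01, of t]
    show "char M t = char N t" unfolding moments by (rule sums_unique2)
  qed
qed

text \<open>The map \<open>exp (- x)\<close> sends the half-line into [0, 1] and turns the Laplace
  transform at a natural number \<open>n\<close> into the \<open>n\<close>-th moment, so agreement
  at the natural numbers is enough. The value at \<open>n = 0\<close> is the total mass
  \<open>c\<close>, by which both measures are normalised.\<close>

lemma measure_eqI_laplace: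
  fixes M N :: "real measure"
  assumes sets: "sets M = sets borel" "sets N = sets borel"
    and fin: "emeasure M UNIV \<noteq> \<infinity>"
    and pos: "AE x in M. 0 \<le> x" "AE x in N. 0 \<le> x"
    and eq: "\<And>n::nat. (\<integral>\<^sup>+x. ennreal (exp (- real n * x)) \<partial>M) = (\<integral>\<^sup>+x. ennreal (exp (- real n * x)) \<partial>N)"
  shows "M = N"
proof -
  note [measurable_cong] = sets
  have sp: "space M = UNIV" "space N = UNIV"
    using sets by (auto dest: sets_eq_imp_space_eq)
  define c where "c = emeasure M UNIV"
  have c: "emeasure M UNIV = c" "emeasure N UNIV = c"
    using eq[of 0] by (auto simp: sp c_def)
  show ?thesis
  \<comment> \<open>The zero measure cannot be normalised to a probability.\<close>
  proof (cases "c = 0")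
    case True
    have null: "emeasure Q A = 0" if "sets Q = sets borel" "emeasure Q UNIV = 0" for Q :: "real measure" and A
      by (metis emeasure_eq_0 that sets.top sets_eq_imp_space_eq space_borel subset_UNIV)
    show ?thesis using sets null[OF sets(1)] null[OF sets(2)] c True by (intro measure_eqI) auto
  next
    case False
    have real_c: "c = ennreal (enn2real c)" "enn2real c > 0"
      using False fin by (auto simp: c_def less_top enn2real_positive_iff zero_less_iff_neq_zero)
    have cancel: "c * (inverse c * a) = a" for a
    proof -
      have "c * inverse c = 1"
        using False fin by (metis c_def divide_ennreal_def ennreal_divide_self infinity_ennreal_def top.not_eq_extremum)
      then show ?thesis by (simp add: mult.assoc[symmetric])
    qed
    let ?D = "\<lambda>Q. distr (scale_measure (inverse c) Q) borel (\<lambda>x::real. exp (- x))"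
    have D: "real_distribution (?D Q) \<and> (AE x in ?D Q. x \<in> {0..1}) \<and>
      (\<integral>x. x ^ n \<partial>?D Q) = enn2real (inverse c * (\<integral>\<^sup>+x. ennreal (exp (- real n * x)) \<partial>Q))"
      if s: "sets Q = sets borel" "emeasure Q UNIV = c" "AE x in Q. 0 \<le> x" for Q :: "real measure" and n
    proof (intro conjI)
      note [measurable_cong] = s(1)
      have spQ: "space Q = UNIV" using s by (auto dest: sets_eq_imp_space_eq)
      have m: "(\<lambda>x::real. exp (- x)) \<in> scale_measure (inverse c) Q \<rightarrow>\<^sub>M borel"
        by (subst measurable_cong_sets[of _ Q _ borel]) (simp_all)
      show "real_distribution (?D Q)"
      proof (intro real_distribution.intro real_distribution_axioms.intro prob_space.prob_space_distr prob_spaceI)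
        show "emeasure (scale_measure (inverse c) Q) (space (scale_measure (inverse c) Q)) = 1"
          using s cancel[of 1] by (simp add: spQ space_scale_measure mult.commute)
      qed (use m in auto)
      have AE: "AE x in scale_measure (inverse c) Q. 0 \<le> x"
        using s(3) by (auto simp: eventually_ae_filter null_sets_def space_scale_measure)
      then show "AE x in ?D Q. x \<in> {0..1}"
        by (subst AE_distr_iff[OF m]) auto
      have "(\<integral>x. x ^ n \<partial>?D Q) = (\<integral>x. exp (- x) ^ n \<partial>scale_measure (inverse c) Q)"
        by (rule integral_distr[OF m]) simp
      also have "\<dots> = enn2real (\<integral>\<^sup>+x. ennreal (exp (- x) ^ n) \<partial>scale_measure (inverse c) Q)"
        by (rule integral_eq_nn_integral) (use m in auto)
      also have "\<dots> = enn2real (inverse c * (\<integral>\<^sup>+x. ennreal (exp (- real n * x)) \<partial>Q))"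
        by (subst nn_integral_scale_measure) (simp_all add: exp_of_nat_mult[symmetric])
      finally show "(\<integral>x. x ^ n \<partial>?D Q) = enn2real (inverse c * (\<integral>\<^sup>+x. ennreal (exp (- real n * x)) \<partial>Q))" .
    qed
    note DM = D[OF sets(1) c(1) pos(1)] and DN = D[OF sets(2) c(2) pos(2)]
    have eqD: "?D M = ?D N"
      using DM DN eq by (intro real_distribution_eqI_moments) auto
    \<comment> \<open>The map \<open>exp (- x)\<close> is inverted by \<open>- ln y\<close>, and
      rescaling by \<open>c\<close> undoes the normalisation. Thus \<open>?D Q\<close> determines
      \<open>Q\<close>.\<close>
    have pull_back: "distr (scale_measure c (?D Q)) borel (\<lambda>y. - ln y) = Q"
      if s: "sets Q = sets borel" for Q :: "real measure"
    proof (rule measure_eqI)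
      note [measurable_cong] = s(1)
      have spQ: "space Q = UNIV" using s by (auto dest: sets_eq_imp_space_eq)
      fix A assume "A \<in> sets (distr (scale_measure c (?D Q)) borel (\<lambda>y. - ln y))"
      then have A: "A \<in> sets borel" by simp
      have m: "(\<lambda>x::real. exp (- x)) \<in> scale_measure (inverse c) Q \<rightarrow>\<^sub>M borel"
        by (subst measurable_cong_sets[of _ Q _ borel]) (simp_all)
      have m2: "(\<lambda>y::real. - ln y) \<in> scale_measure c (?D Q) \<rightarrow>\<^sub>M borel"
        by (subst measurable_cong_sets[of _ borel _ borel]) (simp_all)
      have lnA: "(\<lambda>y::real. - ln y) -` A \<in> sets borel"
        using A measurable_sets[of "\<lambda>y::real. - ln y" borel borel A] by simp
      have "emeasure (distr (scale_measure c (?D Q)) borel (\<lambda>y. - ln y)) A = c * (inverse c * emeasure Q ((\<lambda>x. exp (- x)) -` ((\<lambda>y. - ln y) -` A)))"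
        using A lnA by (simp add: emeasure_distr[OF m2] emeasure_distr[OF m] space_scale_measure spQ)
      also have "(\<lambda>x::real. exp (- x)) -` ((\<lambda>y. - ln y) -` A) = A" by auto
      also have "c * (inverse c * emeasure Q A) = emeasure Q A"
        by (rule cancel)
      finally show "emeasure (distr (scale_measure c (?D Q)) borel (\<lambda>y. - ln y)) A = emeasure Q A" .
    qed (simp add: s)
    show ?thesis using pull_back[OF sets(1)] pull_back[OF sets(2)] unfolding eqD by (rule trans[OF sym])
  qed
qed

section \<open>Tails of the inverse Gaussian kernel and convolutions\<close>

lemma AE_lborel_obtain_Ioo:
  fixes a b :: real
  assumes "AE x in lborel. P x" "a < b"
  obtains x where "a < x" "x < b" "P x"
proof -
  from assms(1) obtain N where N: "{x. \<not> P x} \<subseteq> N" "N \<in> sets lborel" "emeasure lborel N = 0"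
    by (auto elim!: AE_E simp: space_lborel)
  have "\<not> {a<..<b} \<subseteq> N"
  proof
    assume "{a<..<b} \<subseteq> N"
    then have "emeasure lborel {a<..<b} \<le> emeasure lborel N"
      by (intro emeasure_mono N)
    then show False using assms(2) N(3) by simp
  qed
  then obtain x where "x \<in> {a<..<b}" "x \<notin> N" by blast
  then show ?thesis using N(1) that[of x] by auto
qed

text \<open>Divided by \<open>sqrt (2 * pi)\<close> this is the tail of the Levy measure of the
  first passage times of Brownian motion with drift |\<rho>|. The Laplace exponent of that
  subordinator, \<open>sqrt (2 * \<kappa> + \<rho>\<^sup>2) - \<bar>\<rho>\<bar>\<close>, reappears
  in the transform below.\<close>

definition drift_tail :: "real \<Rightarrow> real \<Rightarrow> real" where
  "drift_tail \<rho> s = (LBINT z:{s..}. exp (- \<rho>\<^sup>2 * z / 2) / z powr (3/2))"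

text \<open>The exponential is bounded by 1, and \<open>1 / z powr (3/2)\<close> has the primitive
  \<open>- 2 / sqrt z\<close>, which vanishes at infinity. This bound also serves \<rho> = 0, where
  the exponential gives no decay.\<close>

lemma drift_tail_integrable:
  fixes \<rho> s :: real
  assumes "0 < s"
  shows "set_integrable lborel {s..} (\<lambda>z. exp (- \<rho>\<^sup>2 * z / 2) / z powr (3/2))"
proof -
  let ?F = "\<lambda>z::real. - 2 / sqrt z"
  have "(\<integral>\<^sup>+z. ennreal (indicator {s<..} z * (1 / z powr (3/2))) \<partial>lborel) = ennreal (0 - ?F s)"
  proof (rule nn_integral_FTC_greaterThan)
    show "(?F has_real_derivative 1 / z powr (3/2)) (at z)" if "s < z" for z
    proof -
      have z: "0 < z" using assms that by simp
      have "z powr (3/2) = z * sqrt z"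
        using z powr_add[of z 1 "1/2"] by (simp add: powr_half_sqrt)
      then show ?thesis using z by (auto intro!: derivative_eq_intros simp: field_simps)
    qed
    show "isCont (\<lambda>z. 1 / z powr (3/2)) z" if "s < z" for z
      using assms that by (intro continuous_intros) auto
    have "isCont ?F s" using assms by (intro continuous_intros) auto
    then show "(?F \<longlongrightarrow> ?F s) (at_right s)" by (simp add: isCont_def filterlim_at_split)
    show "(?F \<longlongrightarrow> 0) at_top" by real_asymp
  qed simp
  also have "\<dots> < \<infinity>" by simp
  finally have fin: "(\<integral>\<^sup>+z. ennreal (indicator {s<..} z * (1 / z powr (3/2))) \<partial>lborel) < \<infinity>" .
  have "(\<integral>\<^sup>+z. ennreal (indicator {s..} z * (exp (- \<rho>\<^sup>2 * z / 2) / z powr (3/2))) \<partial>lborel) \<le> (\<integral>\<^sup>+z. ennreal (indicator {s<..} z * (1 / z powr (3/2))) \<partial>lborel)"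
    using AE_lborel_singleton[of s]
    by (intro nn_integral_mono_AE, eventually_elim)
       (use assms in \<open>auto intro!: ennreal_leI divide_right_mono split: split_indicator\<close>)
  then have "(\<integral>\<^sup>+z. ennreal (indicator {s..} z * (exp (- \<rho>\<^sup>2 * z / 2) / z powr (3/2))) \<partial>lborel) < \<infinity>"
    using fin by (rule le_less_trans)
  then show ?thesis
    unfolding set_integrable_def by (intro integrableI_nonneg) (auto split: split_indicator)
qed

lemma nn_integral_drift_tail:
  assumes "0 < s"
  shows "(\<integral>\<^sup>+z. ennreal (indicator {s..} z * (exp (- \<rho>\<^sup>2 * z / 2) / z powr (3/2))) \<partial>lborel) = ennreal (drift_tail \<rho> s)"
  using drift_tail_integrable[OF assms, of \<rho>]
  unfolding drift_tail_def set_lebesgue_integral_def set_integrable_def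
  by (subst nn_integral_eq_integral) (auto split: split_indicator)

lemma drift_tail_nonneg: "0 \<le> drift_tail \<rho> s"
  unfolding drift_tail_def set_lebesgue_integral_def
  by (intro integral_nonneg_AE) (auto split: split_indicator)

lemma drift_tail_antimono:
  assumes "0 < s" "s \<le> t"
  shows "drift_tail \<rho> t \<le> drift_tail \<rho> s"
  unfolding drift_tail_def set_lebesgue_integral_def
  using drift_tail_integrable[of s \<rho>] drift_tail_integrable[of t \<rho>] assms
  by (intro integral_mono) (auto simp: set_integrable_def split: split_indicator)

lemma borel_measurable_drift_tail[measurable]: "drift_tail \<rho> \<in> borel_measurable borel"
proof -
  have "drift_tail \<rho> = (\<lambda>s. \<integral>z. (if s \<le> z then exp (- \<rho>\<^sup>2 * z / 2) / z powr (3/2) else 0) \<partial>lborel)"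
    unfolding drift_tail_def set_lebesgue_integral_def by (intro ext Bochner_Integration.integral_cong) (auto split: split_indicator)
  also have "\<dots> \<in> borel_measurable borel" by measurable
  finally show ?thesis .
qed

lemma isCont_drift_tail:
  assumes "0 < s"
  shows "isCont (drift_tail \<rho>) s"
proof -
  let ?g = "\<lambda>z. exp (- \<rho>\<^sup>2 * z / 2) / z powr (3/2)"
  have int: "integrable lborel (\<lambda>z. indicator {r..} z *\<^sub>R ?g z)" if "0 < r" for r
    using drift_tail_integrable[OF that] by (simp add: set_integrable_def)
  have "(\<lambda>n. drift_tail \<rho> (S n)) \<longlonglongrightarrow> drift_tail \<rho> s" if S: "S \<longlonglongrightarrow> s" for S :: "nat \<Rightarrow> real"
  proof -
    \<comment> \<open>Cutting the sequence off at \<open>s/2\<close> gives one dominating function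
      for all \<open>n\<close>, the kernel on \<open>{s/2..}\<close>. The cut-off has no effect from
      some index on.\<close>
    have "(\<lambda>n. drift_tail \<rho> (max (S n) (s/2))) \<longlonglongrightarrow> drift_tail \<rho> s"
      unfolding drift_tail_def set_lebesgue_integral_def
    proof (rule integral_dominated_convergence[where w="\<lambda>z. indicator {s/2..} z *\<^sub>R ?g z"])
      have lim: "(\<lambda>n. max (S n) (s/2)) \<longlonglongrightarrow> max s (s/2)" using S by (intro tendsto_intros)
      show "AE z in lborel. (\<lambda>n. indicator {max (S n) (s/2)..} z *\<^sub>R ?g z) \<longlonglongrightarrow> indicator {s..} z *\<^sub>R ?g z"
        using AE_lborel_singleton[of s]
      proof eventually_elim
        case (elim z)
        then consider "s < z" | "z < s" by linarith
        then show ?case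
        proof cases
          case 1
          have "eventually (\<lambda>n. max (S n) (s/2) < z) sequentially"
            using order_tendstoD(2)[OF lim, of z] 1 assms by simp
          then have "eventually (\<lambda>n. indicator {max (S n) (s/2)..} z *\<^sub>R ?g z = indicator {s..} z *\<^sub>R ?g z) sequentially"
            by eventually_elim (use 1 in simp)
          then show ?thesis by (rule tendsto_eventually)
        next
          case 2
          have "eventually (\<lambda>n. z < max (S n) (s/2)) sequentially"
            using order_tendstoD(1)[OF lim, of z] 2 assms by simp
          then have "eventually (\<lambda>n. indicator {max (S n) (s/2)..} z *\<^sub>R ?g z = indicator {s..} z *\<^sub>R ?g z) sequentially"
            by eventually_elim (use 2 in \<open>auto split: split_indicator\<close>)
          then show ?thesis by (rule tendsto_eventually)
        qed
      qed
    qed (use assms int in \<open>auto split: split_indicator\<close>)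
    moreover have "eventually (\<lambda>n. s/2 < S n) sequentially"
      using order_tendstoD(1)[OF S, of "s/2"] assms by simp
    then have "eventually (\<lambda>n. drift_tail \<rho> (max (S n) (s/2)) = drift_tail \<rho> (S n)) sequentially"
      by eventually_elim (simp add: max_def)
    ultimately show ?thesis by (blast intro: Lim_transform_eventually)
  qed
  then show ?thesis by (auto simp: continuous_at_sequentially comp_def)
qed

text \<open>Tonelli turns the transform of the tail into the integral of the kernel against
  \<open>(1 - exp (- \<kappa> * z)) / \<kappa>\<close>. This is the difference integral computed
  above with the exponents \<open>\<rho>\<^sup>2 / 2\<close> and
  \<open>\<rho>\<^sup>2 / 2 + \<kappa>\<close>.\<close>

lemma laplace_drift_tail:
  assumes "0 < \<kappa>"
  shows "(\<integral>\<^sup>+s. ennreal (indicator {0<..} s * (exp (- \<kappa> * s) * drift_tail \<rho> s)) \<partial>lborel)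
    = ennreal (sqrt (2 * pi) * (sqrt (2 * \<kappa> + \<rho>\<^sup>2) - \<bar>\<rho>\<bar>) / \<kappa>)"
proof -
  let ?g = "\<lambda>z. exp (- \<rho>\<^sup>2 * z / 2) / z powr (3/2)"
  have "(\<integral>\<^sup>+s. ennreal (indicator {0<..} s * (exp (- \<kappa> * s) * drift_tail \<rho> s)) \<partial>lborel)
     = (\<integral>\<^sup>+s. \<integral>\<^sup>+z. ennreal (if 0 < s \<and> s \<le> z then exp (- \<kappa> * s) * ?g z else 0) \<partial>lborel \<partial>lborel)"
  proof (rule nn_integral_cong)
    fix s :: real
    show "ennreal (indicator {0<..} s * (exp (- \<kappa> * s) * drift_tail \<rho> s)) = (\<integral>\<^sup>+z. ennreal (if 0 < s \<and> s \<le> z then exp (- \<kappa> * s) * ?g z else 0) \<partial>lborel)"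
    proof (cases "0 < s")
      case True
      have "ennreal (exp (- \<kappa> * s) * drift_tail \<rho> s) = ennreal (exp (- \<kappa> * s)) * (\<integral>\<^sup>+z. ennreal (indicator {s..} z * ?g z) \<partial>lborel)"
        unfolding nn_integral_drift_tail[OF True] by (intro ennreal_mult) (simp_all add: drift_tail_nonneg)
      also have "\<dots> = (\<integral>\<^sup>+z. ennreal (exp (- \<kappa> * s)) * ennreal (indicator {s..} z * ?g z) \<partial>lborel)"
        by (rule nn_integral_cmult[symmetric]) simp
      also have "\<dots> = (\<integral>\<^sup>+z. ennreal (if 0 < s \<and> s \<le> z then exp (- \<kappa> * s) * ?g z else 0) \<partial>lborel)"
        using True by (intro nn_integral_cong) (auto simp: ennreal_mult[symmetric] split: split_indicator)
      finally show ?thesis using True by simp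
    qed simp
  qed
  also have "\<dots> = (\<integral>\<^sup>+z. \<integral>\<^sup>+s. ennreal (if 0 < s \<and> s \<le> z then exp (- \<kappa> * s) * ?g z else 0) \<partial>lborel \<partial>lborel)"
    by (rule lborel_pair.Fubini'[symmetric]) measurable
  also have "\<dots> = (\<integral>\<^sup>+z. ennreal (1 / \<kappa>) * ennreal (indicator {0<..} z * ((exp (- (\<rho>\<^sup>2 / 2) * z) - exp (- (\<rho>\<^sup>2 / 2 + \<kappa>) * z)) / z powr (3/2))) \<partial>lborel)"
  proof (rule nn_integral_cong)
    fix z :: real
    show "(\<integral>\<^sup>+s. ennreal (if 0 < s \<and> s \<le> z then exp (- \<kappa> * s) * ?g z else 0) \<partial>lborel) =
      ennreal (1 / \<kappa>) * ennreal (indicator {0<..} z * ((exp (- (\<rho>\<^sup>2 / 2) * z) - exp (- (\<rho>\<^sup>2 / 2 + \<kappa>) * z)) / z powr (3/2)))"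
    proof (cases "0 < z")
      case True
      have "(\<integral>\<^sup>+s. ennreal (if 0 < s \<and> s \<le> z then exp (- \<kappa> * s) * ?g z else 0) \<partial>lborel)
        = (\<integral>\<^sup>+s. ennreal (indicator {0<..<z} s * exp (- \<kappa> * s)) * ennreal (?g z) \<partial>lborel)"
        using AE_lborel_singleton[of z]
        by (intro nn_integral_cong_AE, eventually_elim) (auto simp: ennreal_mult[symmetric] split: split_indicator)
      also have "\<dots> = ennreal ((1 - exp (- \<kappa> * z)) / \<kappa>) * ennreal (?g z)"
        by (subst nn_integral_multc) (simp_all only: nn_integral_exp_Ioo[OF assms True], measurable)
      also have "\<dots> = ennreal (1 / \<kappa>) * ennreal ((1 - exp (- \<kappa> * z)) * ?g z)"
        using assms True by (simp add: ennreal_mult[symmetric])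
      also have "(1 - exp (- \<kappa> * z)) * ?g z = (exp (- (\<rho>\<^sup>2 / 2) * z) - exp (- (\<rho>\<^sup>2 / 2 + \<kappa>) * z)) / z powr (3/2)"
        by (simp add: algebra_simps exp_add[symmetric] diff_divide_distrib)
      finally show ?thesis using True by simp
    next
      case False
      then show ?thesis by (simp add: if_not_P)
    qed
  qed
  also have "\<dots> = ennreal (1 / \<kappa>) * ennreal (2 * sqrt pi * (sqrt (\<rho>\<^sup>2 / 2 + \<kappa>) - sqrt (\<rho>\<^sup>2 / 2)))"
    using nn_integral_exp_diff_powr[of "\<rho>\<^sup>2 / 2" "\<rho>\<^sup>2 / 2 + \<kappa>"] assms
    by (subst nn_integral_cmult) (simp_all del: minus_add_distrib mult_minus_left)
  also have "\<dots> = ennreal (1 / \<kappa> * (2 * sqrt pi * (sqrt (\<rho>\<^sup>2 / 2 + \<kappa>) - sqrt (\<rho>\<^sup>2 / 2))))"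
    using assms by (intro ennreal_mult[symmetric]) auto
  also have "2 * sqrt pi * (sqrt (\<rho>\<^sup>2 / 2 + \<kappa>) - sqrt (\<rho>\<^sup>2 / 2)) = sqrt (2 * pi) * (sqrt (2 * \<kappa> + \<rho>\<^sup>2) - \<bar>\<rho>\<bar>)"
  proof -
    have "sqrt (\<rho>\<^sup>2 / 2 + \<kappa>) = sqrt ((2 * \<kappa> + \<rho>\<^sup>2) / 2)" by (simp add: add_divide_distrib add.commute)
    then have "sqrt (\<rho>\<^sup>2 / 2 + \<kappa>) = sqrt (2 * \<kappa> + \<rho>\<^sup>2) / sqrt 2" "sqrt (\<rho>\<^sup>2 / 2) = \<bar>\<rho>\<bar> / sqrt 2"
      by (simp_all only: real_sqrt_divide real_sqrt_abs)
    moreover have "2 * sqrt pi = sqrt (2 * pi) * sqrt 2"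
      by (simp add: real_sqrt_mult)
    ultimately show ?thesis by (simp add: algebra_simps)
  qed
  finally show ?thesis by simp
qed

text \<open>The weight \<open>exp (- \<kappa> * t) * exp (- \<mu> * s)\<close> equals
  \<open>exp (- (\<kappa> + \<mu>) * s) * exp (- \<kappa> * (t - s))\<close>. With
  \<open>t - s\<close> as a new variable the double integral therefore factorises.\<close>

lemma laplace_convolution:
  fixes L R :: "real \<Rightarrow> real"
  assumes [measurable]: "L \<in> borel_measurable borel" "R \<in> borel_measurable borel"
    and nonneg: "\<And>s. 0 \<le> L s" "\<And>s. 0 \<le> R s"
  shows "(\<integral>\<^sup>+t. ennreal (indicator {0<..} t * exp (- \<kappa> * t)) * (\<integral>\<^sup>+s. ennreal (indicator {0<..<t} s * (exp (- \<mu> * s) * (L s * R (t - s)))) \<partial>lborel) \<partial>lborel)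
   = (\<integral>\<^sup>+s. ennreal (indicator {0<..} s * (exp (- (\<kappa> + \<mu>) * s) * L s)) \<partial>lborel) * (\<integral>\<^sup>+s. ennreal (indicator {0<..} s * (exp (- \<kappa> * s) * R s)) \<partial>lborel)"
proof -
  let ?L = "\<lambda>s. ennreal (indicator {0<..} s * (exp (- (\<kappa> + \<mu>) * s) * L s))"
  let ?R = "\<lambda>s. ennreal (indicator {0<..} s * (exp (- \<kappa> * s) * R s))"
  have "(\<integral>\<^sup>+t. ennreal (indicator {0<..} t * exp (- \<kappa> * t)) * (\<integral>\<^sup>+s. ennreal (indicator {0<..<t} s * (exp (- \<mu> * s) * (L s * R (t - s)))) \<partial>lborel) \<partial>lborel)
    = (\<integral>\<^sup>+t. \<integral>\<^sup>+s. ?L s * ?R (t - s) \<partial>lborel \<partial>lborel)"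
  proof (rule nn_integral_cong)
    fix t :: real
    have "ennreal (indicator {0<..} t * exp (- \<kappa> * t)) * (\<integral>\<^sup>+s. ennreal (indicator {0<..<t} s * (exp (- \<mu> * s) * (L s * R (t - s)))) \<partial>lborel)
      = (\<integral>\<^sup>+s. ennreal (indicator {0<..} t * exp (- \<kappa> * t)) * ennreal (indicator {0<..<t} s * (exp (- \<mu> * s) * (L s * R (t - s)))) \<partial>lborel)"
      by (rule nn_integral_cmult[symmetric]) (simp add: greaterThanLessThan_def)
    also have "\<dots> = (\<integral>\<^sup>+s. ?L s * ?R (t - s) \<partial>lborel)"
    proof (rule nn_integral_cong)
      fix s
      have "exp (- \<kappa> * t) * exp (- \<mu> * s) = exp (- (\<kappa> + \<mu>) * s) * exp (- \<kappa> * (t - s))"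
        by (simp add: exp_add[symmetric] algebra_simps)
      then have "exp (- \<kappa> * t) * (exp (- \<mu> * s) * (L s * R (t - s))) = (exp (- (\<kappa> + \<mu>) * s) * L s) * (exp (- \<kappa> * (t - s)) * R (t - s))"
        by (metis mult.assoc mult.left_commute)
      then show "ennreal (indicator {0<..} t * exp (- \<kappa> * t)) * ennreal (indicator {0<..<t} s * (exp (- \<mu> * s) * (L s * R (t - s)))) = ?L s * ?R (t - s)"
        using nonneg by (auto simp: ennreal_mult[symmetric] split: split_indicator)
    qed
    finally show "ennreal (indicator {0<..} t * exp (- \<kappa> * t)) * (\<integral>\<^sup>+s. ennreal (indicator {0<..<t} s * (exp (- \<mu> * s) * (L s * R (t - s)))) \<partial>lborel) = (\<integral>\<^sup>+s. ?L s * ?R (t - s) \<partial>lborel)" .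
  qed
  also have "\<dots> = (\<integral>\<^sup>+s. \<integral>\<^sup>+t. ?L s * ?R (t - s) \<partial>lborel \<partial>lborel)"
    by (rule lborel_pair.Fubini'[symmetric]) measurable
  also have "\<dots> = (\<integral>\<^sup>+s. ?L s * (\<integral>\<^sup>+v. ?R v \<partial>lborel) \<partial>lborel)"
  proof (rule nn_integral_cong)
    fix s :: real
    have "(\<integral>\<^sup>+t. ?R (t - s) \<partial>lborel) = (\<integral>\<^sup>+v. ?R v \<partial>lborel)"
      using nn_integral_real_affine[of ?R 1 "- s"] by (simp add: add.commute)
    then show "(\<integral>\<^sup>+t. ?L s * ?R (t - s) \<partial>lborel) = ?L s * (\<integral>\<^sup>+v. ?R v \<partial>lborel)"
      by (subst nn_integral_cmult) simp_all
  qed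
  also have "\<dots> = (\<integral>\<^sup>+s. ?L s \<partial>lborel) * (\<integral>\<^sup>+v. ?R v \<partial>lborel)"
    by (rule nn_integral_multc) simp
  finally show ?thesis .
qed

text \<open>Upgrades an almost everywhere identity by continuity of the convolution: after the substitution
  \<open>s = t x\<close>, monotonicity dominates the integrand for nearby \<open>t\<close> by the one for a smaller time \<open>t1\<close>,
  chosen so that the identity holds there and hence the integral is finite.\<close>

lemma convolution_eq_everywhere:
  fixes L R F :: "real \<Rightarrow> real" and \<mu> t :: real
  defines "H \<equiv> \<lambda>t. \<integral>\<^sup>+s. ennreal (indicator {0<..<t} s * (exp (- \<mu> * s) * (L s * R (t - s)))) \<partial>lborel"
  assumes [measurable]: "L \<in> borel_measurable borel" "R \<in> borel_measurable borel"
    and nonneg: "\<And>s. 0 \<le> L s" "\<And>s. 0 \<le> R s"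
    and anti: "\<And>s t. 0 < s \<Longrightarrow> s \<le> t \<Longrightarrow> L t \<le> L s" "\<And>s t. 0 < s \<Longrightarrow> s \<le> t \<Longrightarrow> R t \<le> R s"
    and cont: "\<And>s. 0 < s \<Longrightarrow> isCont L s" "\<And>s. 0 < s \<Longrightarrow> isCont R s"
    and \<mu>: "0 \<le> \<mu>" and F: "isCont F t"
    and eq: "AE t in lborel. 0 < t \<longrightarrow> H t = ennreal (F t)"
    and t: "0 < t"
  shows "H t = ennreal (F t)"
proof -
  define h where "h t x = indicator {0<..<1::real} x * (t * exp (- \<mu> * (t * x)) * (L (t * x) * R (t * (1 - x))))" for t x
  have H: "H t = (\<integral>\<^sup>+x. ennreal (h t x) \<partial>lborel)" if "0 < t" for t
  proof -
    have "H t = ennreal t * (\<integral>\<^sup>+x. ennreal (indicator {0<..<t} (0 + t * x) * (exp (- \<mu> * (0 + t * x)) * (L (0 + t * x) * R (t - (0 + t * x))))) \<partial>lborel)"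
      unfolding H_def using that by (subst nn_integral_real_affine[where c=t and t=0]) (auto simp: greaterThanLessThan_def)
    also have "\<dots> = (\<integral>\<^sup>+x. ennreal t * ennreal (indicator {0<..<t} (0 + t * x) * (exp (- \<mu> * (0 + t * x)) * (L (0 + t * x) * R (t - (0 + t * x))))) \<partial>lborel)"
      by (rule nn_integral_cmult[symmetric]) (simp add: greaterThanLessThan_def)
    also have "\<dots> = (\<integral>\<^sup>+x. ennreal (h t x) \<partial>lborel)"
      using that nonneg unfolding h_def
      by (intro nn_integral_cong)
         (auto simp: ennreal_mult[symmetric] zero_less_mult_iff algebra_simps split: split_indicator)
    finally show ?thesis .
  qed
  obtain t1 where t1: "0 < t1" "t1 < t" "H t1 = ennreal (F t1)"
    using AE_lborel_obtain_Ioo[OF eq t] by blast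
  \<comment> \<open>Times with the identity are chosen to decrease to \<open>t\<close>. They stay
    above \<open>t1\<close>, as the domination needs, and below \<open>t + 1\<close>.\<close>
  have "\<exists>x. t < x \<and> x < t + 1 / Suc n \<and> H x = ennreal (F x)" for n
    using AE_lborel_obtain_Ioo[OF eq, of t "t + 1 / Suc n"] t by (auto intro: order.strict_trans)
  then obtain T where T: "\<And>n. t < T n" "\<And>n. T n < t + 1 / Suc n" "\<And>n. H (T n) = ennreal (F (T n))"
    by metis
  have T_le: "T n \<le> t + 1" for n
    using T(2)[of n] by (rule order.strict_implies_order[OF order.strict_trans2]) (simp add: field_simps)
  have T_lim: "T \<longlonglongrightarrow> t"
  proof (rule tendsto_sandwich[OF _ _ tendsto_const])
    show "(\<lambda>n. t + 1 / real (Suc n)) \<longlonglongrightarrow> t" by real_asymp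
  qed (use T(1,2) in \<open>auto intro!: always_eventually less_imp_le simp del: of_nat_Suc\<close>)
  have [measurable]: "h t \<in> borel_measurable borel" for t
    unfolding h_def greaterThanLessThan_def by measurable
  \<comment> \<open>The factor \<open>t + 1\<close> bounds \<open>T n\<close>. The factors
    \<open>exp (\<mu> * t1)\<close> and \<open>1 / t1\<close> compensate the weight and the Jacobian
    contained in \<open>h t1\<close>.\<close>
  let ?w = "\<lambda>x. ennreal ((t + 1) * exp (\<mu> * t1) / t1) * ennreal (h t1 x)"
  have "(\<lambda>n. \<integral>\<^sup>+x. ennreal (h (T n) x) \<partial>lborel) \<longlonglongrightarrow> (\<integral>\<^sup>+x. ennreal (h t x) \<partial>lborel)"
  proof (rule nn_integral_dominated_convergence[where w="?w"])
    show "AE x in lborel. ennreal (h (T n) x) \<le> ?w x" for n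
    proof (rule AE_I2)
      fix x :: real
      show "ennreal (h (T n) x) \<le> ?w x"
      proof (cases "x \<in> {0<..<1}")
        case True
        have T1: "t1 \<le> T n" "0 < T n" using T(1)[of n] t1 by auto
        have "T n * exp (- \<mu> * (T n * x)) * (L (T n * x) * R (T n * (1 - x))) \<le> (t + 1) * 1 * (L (t1 * x) * R (t1 * (1 - x)))"
          using True T1 t1 T_le[of n] nonneg \<mu>
          by (intro mult_mono anti) (auto intro!: mult_nonneg_nonneg)
        also have "\<dots> \<le> (t + 1) * (exp (\<mu> * t1) * exp (- \<mu> * (t1 * x))) * (L (t1 * x) * R (t1 * (1 - x)))"
        proof (intro mult_right_mono mult_left_mono)
          have "\<mu> * (t1 * x) \<le> \<mu> * t1" using \<mu> True t1 by (intro mult_left_mono) auto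
          then show "1 \<le> exp (\<mu> * t1) * exp (- \<mu> * (t1 * x))" by (simp add: exp_add[symmetric])
        qed (use nonneg t in auto)
        also have "\<dots> = (t + 1) * exp (\<mu> * t1) / t1 * (t1 * exp (- \<mu> * (t1 * x)) * (L (t1 * x) * R (t1 * (1 - x))))"
          using t1 by simp
        finally show ?thesis
          unfolding h_def using True t t1 nonneg by (simp add: ennreal_mult[symmetric])
      qed (simp add: h_def)
    qed
    show "(\<integral>\<^sup>+x. ?w x \<partial>lborel) < \<infinity>"
      using t1 H[of t1] by (subst nn_integral_cmult) (auto simp: ennreal_mult_less_top)
    show "AE x in lborel. (\<lambda>n. ennreal (h (T n) x)) \<longlonglongrightarrow> ennreal (h t x)"
    proof (rule AE_I2)
      fix x :: real
      show "(\<lambda>n. ennreal (h (T n) x)) \<longlonglongrightarrow> ennreal (h t x)"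
      proof (cases "x \<in> {0<..<1}")
        case True
        have "(\<lambda>n. L (T n * x)) \<longlonglongrightarrow> L (t * x)" "(\<lambda>n. R (T n * (1 - x))) \<longlonglongrightarrow> R (t * (1 - x))"
          using True t by (auto intro!: isCont_tendsto_compose[OF cont(1)] isCont_tendsto_compose[OF cont(2)] tendsto_intros T_lim)
        then show ?thesis unfolding h_def
          by (intro tendsto_intros T_lim)
      qed (simp add: h_def)
    qed
  qed simp_all
  then have "(\<lambda>n. H (T n)) \<longlonglongrightarrow> H t"
    using T(1) t H by (simp add: less_trans[OF t])
  moreover have "(\<lambda>n. H (T n)) \<longlonglongrightarrow> ennreal (F t)"
    unfolding T(3) by (intro tendsto_ennrealI isCont_tendsto_compose[OF F] T_lim)
  ultimately show ?thesis by (rule LIMSEQ_unique)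
qed

section \<open>The resolvent of drifted Brownian motion\<close>

text \<open>Here \<open>u\<close> (extended to \<open>x < 0\<close> as the bounded \<open>C\<^sup>1\<close> solution) solves
  \<open>u'' / 2 + \<rho> u' - (\<kappa> + \<mu> 1[x \<ge> 0]) u = -1\<close>; the function \<open>f = \<kappa> u - u'' / 2 - \<rho> u'\<close> is then explicit, and its
  resolvent is \<open>u\<close>. The condition \<open>\<mu> \<le> \<kappa>\<close> makes \<open>f\<close> nonnegative.\<close>

lemma resolvent_exponential:
  fixes \<rho> \<kappa> \<mu> x :: real
  assumes par: "0 < \<mu>" "\<mu> \<le> \<kappa>" "0 \<le> x"
  defines "\<gamma> \<equiv> sqrt (2 * \<kappa> + \<rho>\<^sup>2)" and "\<delta> \<equiv> sqrt (2 * (\<kappa> + \<mu>) + \<rho>\<^sup>2)"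
  defines "a \<equiv> (\<delta> - \<gamma>) / ((\<kappa> + \<mu>) * (\<rho> + \<gamma>))"
  defines "u \<equiv> \<lambda>x. 1 / (\<kappa> + \<mu>) + a * exp (- (\<rho> + \<delta>) * x)"
  defines "f \<equiv> \<lambda>y::real. if y < 0 then 1 else 1 - \<mu> * u y"
  shows "0 \<le> f y" "0 \<le> u x"
    "u 0 = 2 / ((\<delta> - \<rho>) * (\<gamma> + \<rho>))"
    "(\<integral>\<^sup>+y. ennreal (f y) * ennreal (exp (\<rho> * (y - x) - \<gamma> * \<bar>y - x\<bar>) / \<gamma>) \<partial>lborel) = ennreal (u x)"
proof -
  have \<kappa>: "0 < \<kappa>" using par by simp
  have sq: "\<gamma>\<^sup>2 = 2 * \<kappa> + \<rho>\<^sup>2" "\<delta>\<^sup>2 = 2 * (\<kappa> + \<mu>) + \<rho>\<^sup>2"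
    using par \<kappa> by (simp_all add: \<gamma>_def \<delta>_def)
  have \<gamma>\<rho>: "\<bar>\<rho>\<bar> < \<gamma>" unfolding \<gamma>_def using \<kappa> by (intro real_less_rsqrt) simp
  have \<gamma>\<delta>: "\<gamma> < \<delta>" unfolding \<gamma>_def \<delta>_def using par \<kappa> by simp
  have pos: "0 < \<rho> + \<gamma>" "0 < \<gamma> - \<rho>" "0 < \<gamma>" "0 < \<delta>" "0 < \<delta> - \<rho>" "0 < \<rho> + \<delta>" "0 < \<kappa> + \<mu>" "0 < \<gamma> + \<delta>" "0 < \<delta> - \<gamma>"
    using \<gamma>\<rho> \<gamma>\<delta> par by auto
  \<comment> \<open>On the negative side the bounded solution is
    \<open>1 / \<kappa> + b * exp ((\<gamma> - \<rho>) * x)\<close> for some \<open>b\<close>.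
    Matching value and derivative at 0 and eliminating \<open>b\<close> gives \<open>a = \<mu> *
    (\<gamma> - \<rho>) / (\<kappa> * (\<kappa> + \<mu>) * (\<gamma> + \<delta>))\<close>. These
    factorisations turn it into the form in which \<open>a\<close> is defined.\<close>
  have fac: "(\<gamma> - \<rho>) * (\<rho> + \<gamma>) = 2 * \<kappa>" "(\<delta> - \<rho>) * (\<rho> + \<delta>) = 2 * (\<kappa> + \<mu>)" "(\<delta> - \<gamma>) * (\<gamma> + \<delta>) = 2 * \<mu>"
    using sq by (auto simp: power2_eq_square algebra_simps)
  have a: "0 < a" unfolding a_def using pos by simp
  have "u 0 = (\<rho> + \<delta>) / ((\<kappa> + \<mu>) * (\<rho> + \<gamma>))"
  proof -
    have "1 / (\<kappa> + \<mu>) = (\<rho> + \<gamma>) / ((\<kappa> + \<mu>) * (\<rho> + \<gamma>))" using pos by simp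
    then have "u 0 = (\<rho> + \<gamma>) / ((\<kappa> + \<mu>) * (\<rho> + \<gamma>)) + (\<delta> - \<gamma>) / ((\<kappa> + \<mu>) * (\<rho> + \<gamma>))"
      unfolding u_def a_def by simp
    then show ?thesis unfolding add_divide_distrib[symmetric] by simp
  qed
  also have "\<dots> = 2 / ((\<delta> - \<rho>) * (\<gamma> + \<rho>))"
  proof -
    have "(\<rho> + \<delta>) * ((\<delta> - \<rho>) * (\<gamma> + \<rho>)) = 2 * ((\<kappa> + \<mu>) * (\<rho> + \<gamma>))"
      using fac(2) by (metis add.commute mult.assoc mult.commute)
    then show ?thesis using pos by (simp add: frac_eq_eq)
  qed
  finally show u0: "u 0 = 2 / ((\<delta> - \<rho>) * (\<gamma> + \<rho>))" .
  have u_pos: "0 < u y" for y unfolding u_def using a pos by (simp add: add_pos_nonneg)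
  show "0 \<le> u x" using u_pos[of x] by simp
  \<comment> \<open>On the half-line \<open>u\<close> is largest at 0. Replacing \<delta> by the
    smaller \<gamma> in the value there bounds it by \<open>1 / \<kappa>\<close>.\<close>
  have u_le: "\<mu> * u y \<le> 1" if "0 \<le> y" for y
  proof -
    have "u y \<le> u 0" unfolding u_def using a pos that by (simp add: mult_nonneg_nonneg mult_le_cancel_left1 del: minus_add_distrib)
    also have "u 0 \<le> 2 / ((\<gamma> - \<rho>) * (\<gamma> + \<rho>))"
      unfolding u0 using pos by (intro divide_left_mono mult_right_mono) auto
    also have "\<dots> = 1 / \<kappa>" using fac(1) by (simp add: add.commute)
    finally have "u y \<le> 1 / \<kappa>" .
    then have "\<mu> * u y \<le> \<kappa> * (1 / \<kappa>)"
      using par u_pos[of y] by (intro mult_mono) auto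
    then show ?thesis using \<kappa> by simp
  qed
  then show f_nonneg: "0 \<le> f y" for y unfolding f_def by auto
  define k where "k y = exp (\<rho> * (y - x) - \<gamma> * \<bar>y - x\<bar>) / \<gamma>" for y
  define c where "c = \<kappa> / (\<kappa> + \<mu>)"
  have c: "c = 1 - \<mu> / (\<kappa> + \<mu>)" unfolding c_def using pos by (simp add: field_simps)
  have f_pos: "f y = c - \<mu> * a * exp (- (\<rho> + \<delta>) * y)" if "0 \<le> y" for y
    using that by (simp add: f_def u_def c algebra_simps)
  have k_nonneg: "0 \<le> k y" for y unfolding k_def using pos by simp
  have [measurable]: "f \<in> borel_measurable borel" "k \<in> borel_measurable borel"
    unfolding f_def u_def k_def by measurable
  \<comment> \<open>The resolvent kernel grows at rate \<open>p\<close> up to \<open>x\<close> and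
    decays at rate \<open>m\<close> beyond it, while the exponential in \<open>f\<close> decays at
    rate \<alpha>. Their products have the rates \<open>p - \<alpha> = - d\<close> and
    \<open>- m - \<alpha> = - q\<close>. The functions \<open>F1\<close>, \<open>F2\<close>,
    \<open>F3\<close> are primitives of \<open>f\<close> times the kernel to the left of 0, between
    0 and \<open>x\<close>, and to the right of \<open>x\<close>.\<close>
  define p m d q \<alpha> where "p = \<rho> + \<gamma>" and "m = \<gamma> - \<rho>" and "d = \<delta> - \<gamma>" and "q = \<gamma> + \<delta>" and "\<alpha> = \<rho> + \<delta>"
  note pars = p_def m_def d_def q_def \<alpha>_def
  have pos': "0 < p" "0 < m" "0 < d" "0 < q" "0 < \<alpha>" "0 < \<gamma>" using pos by (auto simp: pars)
  define F1 where "F1 y = exp (p * (y - x)) / (\<gamma> * p)" for y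
  define F2 where "F2 y = (c * exp (p * (y - x)) / p + \<mu> * a * exp (p * (y - x) - \<alpha> * y) / d) / \<gamma>" for y
  define F3 where "F3 y = (\<mu> * a * exp (- m * (y - x) - \<alpha> * y) / q - c * exp (- m * (y - x)) / m) / \<gamma>" for y
  have f_pos: "f y = c - \<mu> * a * exp (- \<alpha> * y)" if "0 \<le> y" for y
    unfolding \<alpha>_def by (rule f_pos[OF that])
  have kl: "k y = exp (p * (y - x)) / \<gamma>" if "y \<le> x" for y
    unfolding k_def using that by (simp add: abs_if pars algebra_simps)
  have kr: "k y = exp (- m * (y - x)) / \<gamma>" if "x \<le> y" for y
    unfolding k_def using that by (simp add: abs_if pars algebra_simps)
  have cont_transfer: "isCont g y" if "isCont h y" "open S" "y \<in> S" "\<And>z. z \<in> S \<Longrightarrow> g z = h z" for g h :: "real \<Rightarrow> real" and y S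
  proof -
    have "eventually (\<lambda>z. z \<in> S) (nhds y)" using that by (intro eventually_nhds_in_open)
    then have "eventually (\<lambda>z. g z = h z) (nhds y)" using that(4) by (rule eventually_mono)
    then show ?thesis using that(1) isCont_cong by blast
  qed
  have D2: "(F2 has_real_derivative f y * (exp (p * (y - x)) / \<gamma>)) (at y)" if y: "0 \<le> y" for y
  proof -
    have "(F2 has_real_derivative (c * (exp (p * (y - x)) * p) / p + \<mu> * a * (exp (p * (y - x) - \<alpha> * y) * (p - \<alpha>)) / d) / \<gamma>) (at y)"
      unfolding F2_def using pos' by (auto intro!: derivative_eq_intros)
    also have "p - \<alpha> = - d" by (simp add: pars)
    also have "exp (p * (y - x) - \<alpha> * y) = exp (- \<alpha> * y) * exp (p * (y - x))"
      by (simp add: exp_add[symmetric])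
    finally show ?thesis
      unfolding f_pos[OF y] using pos' by (simp add: algebra_simps diff_divide_distrib)
  qed
  have D3: "(F3 has_real_derivative f y * (exp (- m * (y - x)) / \<gamma>)) (at y)" if y: "0 \<le> y" for y
  proof -
    have "(F3 has_real_derivative (\<mu> * a * (exp (- m * (y - x) - \<alpha> * y) * (- m - \<alpha>)) / q - c * (exp (- m * (y - x)) * (- m)) / m) / \<gamma>) (at y)"
      unfolding F3_def using pos' by (auto intro!: derivative_eq_intros)
    also have "- m - \<alpha> = - q" by (simp add: pars)
    also have "exp (- m * (y - x) - \<alpha> * y) = exp (- \<alpha> * y) * exp (- m * (y - x))"
      by (simp add: exp_add[symmetric])
    finally show ?thesis
      unfolding f_pos[OF y] using pos' by (simp add: algebra_simps diff_divide_distrib)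
  qed
  have cont_f: "isCont f y" if "0 < y" for y
    by (rule cont_transfer[where h="\<lambda>y. c - \<mu> * a * exp (- \<alpha> * y)" and S="{0<..}"]) (use that f_pos in \<open>auto intro!: continuous_intros\<close>)
  have I1: "(\<integral>\<^sup>+y. ennreal (indicator {..<0} y * (f y * k y)) \<partial>lborel) = ennreal (F1 0 - 0)"
  proof -
    have "(\<integral>\<^sup>+y. ennreal (indicator {..<0} y * (f y * k y)) \<partial>lborel) = (\<integral>\<^sup>+y. ennreal (indicator {..<0} y * (exp (p * (y - x)) / \<gamma>)) \<partial>lborel)"
      using par by (intro nn_integral_cong) (auto simp: f_def kl split: split_indicator)
    also have "\<dots> = ennreal (F1 0 - 0)"
    proof (rule nn_integral_FTC_lessThan)
      show "(F1 has_real_derivative exp (p * (y - x)) / \<gamma>) (at y)" for y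
        unfolding F1_def using pos' by (auto intro!: derivative_eq_intros)
      have "((\<lambda>y. exp (p * (y - x)) / (\<gamma> * p)) \<longlongrightarrow> 0 / (\<gamma> * p)) at_bot"
      proof (intro tendsto_divide tendsto_const filterlim_compose[OF exp_at_bot])
        show "filterlim (\<lambda>y. p * (y - x)) at_bot at_bot"
          using pos' by real_asymp
      qed (use pos' in auto)
      then show "(F1 \<longlongrightarrow> 0) at_bot"
        unfolding F1_def by simp
      have "isCont F1 0" unfolding F1_def using pos' by (intro continuous_intros) auto
      then show "(F1 \<longlongrightarrow> F1 0) (at_left 0)"
        by (simp add: isCont_def filterlim_at_split)
    qed (use pos' in \<open>auto intro!: continuous_intros\<close>)
    finally show ?thesis .
  qed
  have I2: "(\<integral>\<^sup>+y. ennreal (indicator {0<..<x} y * (f y * k y)) \<partial>lborel) = ennreal (F2 x - F2 0)"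
  proof (cases "x = 0")
    case False
    have "(\<integral>\<^sup>+y. ennreal (indicator {0<..<x} y * (f y * k y)) \<partial>lborel) = (\<integral>\<^sup>+y. ennreal (indicator {0<..<x} y * (f y * (exp (p * (y - x)) / \<gamma>))) \<partial>lborel)"
      by (intro nn_integral_cong) (auto simp: kl split: split_indicator)
    also have "\<dots> = ennreal (F2 x - F2 0)"
    proof (rule nn_integral_FTC_greaterThanLessThan)
      show "continuous_on {0..x} F2" unfolding F2_def using pos' by (intro continuous_intros) auto
      show "isCont (\<lambda>y. f y * (exp (p * (y - x)) / \<gamma>)) y" if "0 < y" for y
        using that cont_f pos' by (intro continuous_intros) auto
    qed (use False par D2 f_nonneg pos' in auto)
    finally show ?thesis .
  qed simp
  have I3: "(\<integral>\<^sup>+y. ennreal (indicator {x<..} y * (f y * k y)) \<partial>lborel) = ennreal (0 - F3 x)"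
  proof -
    have "(\<integral>\<^sup>+y. ennreal (indicator {x<..} y * (f y * k y)) \<partial>lborel) = (\<integral>\<^sup>+y. ennreal (indicator {x<..} y * (f y * (exp (- m * (y - x)) / \<gamma>))) \<partial>lborel)"
      by (intro nn_integral_cong) (auto simp: kr split: split_indicator)
    also have "\<dots> = ennreal (0 - F3 x)"
    proof (rule nn_integral_FTC_greaterThan)
      show "(F3 has_real_derivative f y * (exp (- m * (y - x)) / \<gamma>)) (at y)" if "x < y" for y
        using D3 that par by simp
      show "isCont (\<lambda>y. f y * (exp (- m * (y - x)) / \<gamma>)) y" if "x < y" for y
        using that par cont_f pos' by (intro continuous_intros) auto
      show "0 \<le> f y * (exp (- m * (y - x)) / \<gamma>)" for y using f_nonneg[of y] pos' by simp
      have "isCont F3 x" unfolding F3_def using pos' by (intro continuous_intros) auto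
      then show "(F3 \<longlongrightarrow> F3 x) (at_right x)"
        by (simp add: isCont_def filterlim_at_split)
      have "((\<lambda>y. (\<mu> * a * exp (- m * (y - x) - \<alpha> * y) / q - c * exp (- m * (y - x)) / m) / \<gamma>) \<longlongrightarrow> (\<mu> * a * 0 / q - c * 0 / m) / \<gamma>) at_top"
      proof (intro tendsto_divide tendsto_diff tendsto_mult tendsto_const filterlim_compose[OF exp_at_bot])
        show "filterlim (\<lambda>y. - m * (y - x)) at_bot at_top" "filterlim (\<lambda>y. - m * (y - x) - \<alpha> * y) at_bot at_top"
          using pos' by real_asymp+
      qed (use pos' in auto)
      then show "(F3 \<longlongrightarrow> 0) at_top" unfolding F3_def by simp
    qed
    finally show ?thesis .
  qed
  \<comment> \<open>The three pieces are known only as \<open>ennreal\<close> values, where a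
    negative number would be truncated to 0. Each must be shown nonnegative before they can be added
    as reals.\<close>
  have "0 \<le> F1 0" unfolding F1_def using pos' by simp
  moreover have "F2 0 \<le> F2 x"
  proof (rule DERIV_nonneg_imp_nondecreasing[of 0 x F2])
    show "0 \<le> x" by (rule par)
    fix y assume "0 \<le> y" "y \<le> x"
    moreover have "0 \<le> f y * (exp (p * (y - x)) / \<gamma>)" using f_nonneg[of y] pos' by simp
    ultimately show "\<exists>d. (F2 has_real_derivative d) (at y) \<and> 0 \<le> d"
      using D2 by blast
  qed
  moreover have "0 \<le> - F3 x"
  proof -
    have "\<mu> * a * exp (- \<alpha> * x) / q \<le> c / m"
      using f_nonneg[of x] f_pos[of x] par pos a by (intro frac_le) (auto simp: pars c_def)
    then show ?thesis unfolding F3_def using pos' by (simp add: divide_le_0_iff)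
  qed
  ultimately have nonneg: "0 \<le> F1 0" "0 \<le> F2 x - F2 0" "0 \<le> - F3 x" by auto
  have "(\<integral>\<^sup>+y. ennreal (f y) * ennreal (k y) \<partial>lborel) =
     (\<integral>\<^sup>+y. (ennreal (indicator {..<0} y * (f y * k y)) + ennreal (indicator {0<..<x} y * (f y * k y))) + ennreal (indicator {x<..} y * (f y * k y)) \<partial>lborel)"
    using AE_lborel_singleton[of 0] AE_lborel_singleton[of x]
    by (intro nn_integral_cong_AE, eventually_elim)
       (use par f_nonneg k_nonneg in \<open>auto simp: ennreal_mult[symmetric] split: split_indicator\<close>)
  also have "\<dots> = ennreal (F1 0 - 0) + ennreal (F2 x - F2 0) + ennreal (0 - F3 x)"
    by (subst nn_integral_add, measurable)+ (simp only: I1 I2 I3)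
  also have "\<dots> = ennreal (F1 0 + (F2 x - F2 0) - F3 x)"
    using nonneg by (simp add: ennreal_plus[symmetric] del: ennreal_plus)
  also have "F1 0 + (F2 x - F2 0) - F3 x = u x"
  proof -
    \<comment> \<open>The sum is sorted by \<open>E\<close>, constants and \<open>e\<close>. The
      coefficient of \<open>E\<close> vanishes because of the choice of \<open>a\<close>.\<close>
    define E where "E = exp (- p * x)"
    define e where "e = exp (- \<alpha> * x)"
    have "F1 0 = E / (\<gamma> * p)" "F2 x = (c / p + \<mu> * a * e / d) / \<gamma>"
      "F2 0 = (c * E / p + \<mu> * a * E / d) / \<gamma>"
      "F3 x = (\<mu> * a * e / q - c / m) / \<gamma>"
      by (simp_all add: F1_def F2_def F3_def E_def e_def)
    then have "F1 0 + (F2 x - F2 0) - F3 x = E / \<gamma> * ((1 - c) / p - \<mu> * (a / d))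
       + c / \<gamma> * (1 / p + 1 / m) + \<mu> * a * e / \<gamma> * (1 / d - 1 / q)"
      by (simp add: algebra_simps add_divide_distrib diff_divide_distrib)
    also have "a / d = 1 / ((\<kappa> + \<mu>) * p)"
      unfolding a_def pars using pos by simp
    also have "(1 - c) / p = \<mu> * (1 / ((\<kappa> + \<mu>) * p))"
      unfolding c by simp
    also have "1 / p + 1 / m = 2 * \<gamma> / (m * p)"
      using pos' by (simp add: add_frac_eq) (simp add: pars)
    also have "m * p = 2 * \<kappa>" unfolding pars by (rule fac)
    also have "1 / d - 1 / q = 2 * \<gamma> / (d * q)"
      using pos' by (simp add: diff_frac_eq) (simp add: pars)
    also have "d * q = 2 * \<mu>" unfolding pars by (rule fac)
    finally have "F1 0 + (F2 x - F2 0) - F3 x = c / \<kappa> + a * e"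
      using pos \<kappa> par by simp
    then show ?thesis unfolding u_def e_def c_def \<alpha>_def using \<kappa> by simp
  qed
  finally show "(\<integral>\<^sup>+y. ennreal (f y) * ennreal (exp (\<rho> * (y - x) - \<gamma> * \<bar>y - x\<bar>) / \<gamma>) \<partial>lborel) = ennreal (u x)"
    unfolding k_def .
qed

text \<open>Expanding the square in the exponent splits off the Girsanov factor
  \<open>exp (\<rho> * (y - x))\<close> and leaves the driftless heat kernel discounted at the rate
  \<open>\<kappa> + \<rho>\<^sup>2 / 2 = \<gamma>\<^sup>2 / 2\<close>.\<close>

lemma laplace_normal_density:
  fixes \<kappa> \<rho> x y :: real
  assumes "0 < \<kappa>" "x \<noteq> y"
  defines "\<gamma> \<equiv> sqrt (2 * \<kappa> + \<rho>\<^sup>2)"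
  shows "(\<integral>\<^sup>+r. ennreal (indicator {0<..} r * exp (- \<kappa> * r)) * ennreal (normal_density (x + \<rho> * r) (sqrt r) y) \<partial>lborel)
    = ennreal (exp (\<rho> * (y - x) - \<gamma> * \<bar>y - x\<bar>) / \<gamma>)"
proof -
  have \<gamma>: "0 < \<gamma>" "\<gamma>\<^sup>2 = 2 * \<kappa> + \<rho>\<^sup>2" using assms(1) by (simp_all add: \<gamma>_def add_pos_nonneg)
  let ?z = "y - x"
  let ?k = "\<lambda>r. indicator {0<..} r * (exp (- ?z\<^sup>2 / (2 * r) - \<gamma>\<^sup>2 * r / 2) / sqrt (2 * pi * r))"
  have "(\<integral>\<^sup>+r. ennreal (indicator {0<..} r * exp (- \<kappa> * r)) * ennreal (normal_density (x + \<rho> * r) (sqrt r) y) \<partial>lborel)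
    = (\<integral>\<^sup>+r. ennreal (exp (\<rho> * ?z)) * ennreal (?k r) \<partial>lborel)"
  proof (rule nn_integral_cong)
    fix r :: real
    show "ennreal (indicator {0<..} r * exp (- \<kappa> * r)) * ennreal (normal_density (x + \<rho> * r) (sqrt r) y) = ennreal (exp (\<rho> * ?z)) * ennreal (?k r)"
    proof (cases "0 < r")
      case True
      have e: "- \<kappa> * r + - (y - (x + \<rho> * r))\<^sup>2 / (2 * r) = \<rho> * ?z + (- ?z\<^sup>2 / (2 * r) - \<gamma>\<^sup>2 * r / 2)"
        unfolding \<gamma>(2) using True by (simp add: power2_eq_square field_simps)
      have "exp (- \<kappa> * r) * normal_density (x + \<rho> * r) (sqrt r) y = exp (- \<kappa> * r + - (y - (x + \<rho> * r))\<^sup>2 / (2 * r)) / sqrt (2 * pi * r)"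
        using True by (simp add: normal_density_def exp_add[symmetric])
      also have "\<dots> = exp (\<rho> * ?z) * (exp (- ?z\<^sup>2 / (2 * r) - \<gamma>\<^sup>2 * r / 2) / sqrt (2 * pi * r))"
        unfolding e by (simp only: exp_add times_divide_eq_right)
      finally show ?thesis using True
        by (simp add: ennreal_mult[symmetric] normal_density_nonneg)
    qed simp
  qed
  also have "\<dots> = ennreal (exp (\<rho> * ?z)) * ennreal (exp (- \<gamma> * \<bar>?z\<bar>) / \<gamma>)"
  proof -
    have "(\<integral>\<^sup>+r. ennreal (?k r) \<partial>lborel) = ennreal (exp (- \<gamma> * \<bar>?z\<bar>) / \<gamma>)"
      using assms(2) by (intro nn_integral_heat_kernel \<gamma>(1)) simp
    moreover have "(\<integral>\<^sup>+r. ennreal (exp (\<rho> * ?z)) * ennreal (?k r) \<partial>lborel) = ennreal (exp (\<rho> * ?z)) * (\<integral>\<^sup>+r. ennreal (?k r) \<partial>lborel)"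
      by (rule nn_integral_cmult) measurable
    ultimately show ?thesis by (simp only:)
  qed
  also have "\<dots> = ennreal (exp (\<rho> * ?z - \<gamma> * \<bar>?z\<bar>) / \<gamma>)"
    using \<gamma> by (simp add: ennreal_mult[symmetric] exp_add[symmetric])
  finally show ?thesis .
qed

text \<open>For \<open>r > 0\<close> this is the transition semigroup of the motion with drift. At
  \<open>r = 0\<close> the density has standard deviation 0 and evaluates to 0, so the value there
  is 0 and not \<open>f x\<close>; it is only used at positive times or under a weight vanishing
  elsewhere.\<close>

definition drift_semigroup :: "real \<Rightarrow> (real \<Rightarrow> ennreal) \<Rightarrow> real \<Rightarrow> real \<Rightarrow> ennreal" where
  "drift_semigroup \<rho> f r x = (\<integral>\<^sup>+y. f y * ennreal (normal_density (x + \<rho> * r) (sqrt r) y) \<partial>lborel)"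

lemma measurable_drift_semigroup [measurable (raw)]:
  assumes [measurable]: "f \<in> borel_measurable borel" "g \<in> borel_measurable N" "h \<in> borel_measurable N"
  shows "(\<lambda>x. drift_semigroup \<rho> f (g x) (h x)) \<in> borel_measurable N"
  unfolding drift_semigroup_def normal_density_def by measurable

lemma resolvent_drift_semigroup:
  fixes \<kappa> \<rho> x :: real
  assumes "0 < \<kappa>" and [measurable]: "f \<in> borel_measurable borel"
  defines "\<gamma> \<equiv> sqrt (2 * \<kappa> + \<rho>\<^sup>2)"
  shows "(\<integral>\<^sup>+r. ennreal (indicator {0<..} r * exp (- \<kappa> * r)) * drift_semigroup \<rho> f r x \<partial>lborel)
    = (\<integral>\<^sup>+y. f y * ennreal (exp (\<rho> * (y - x) - \<gamma> * \<bar>y - x\<bar>) / \<gamma>) \<partial>lborel)"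
proof -
  have "(\<integral>\<^sup>+r. ennreal (indicator {0<..} r * exp (- \<kappa> * r)) * drift_semigroup \<rho> f r x \<partial>lborel)
     = (\<integral>\<^sup>+r. \<integral>\<^sup>+y. ennreal (indicator {0<..} r * exp (- \<kappa> * r)) * (f y * ennreal (normal_density (x + \<rho> * r) (sqrt r) y)) \<partial>lborel \<partial>lborel)"
    unfolding drift_semigroup_def by (subst nn_integral_cmult) simp_all
  also have "\<dots> = (\<integral>\<^sup>+y. \<integral>\<^sup>+r. ennreal (indicator {0<..} r * exp (- \<kappa> * r)) * (f y * ennreal (normal_density (x + \<rho> * r) (sqrt r) y)) \<partial>lborel \<partial>lborel)"
    by (rule lborel_pair.Fubini'[symmetric]) (unfold normal_density_def, measurable)
  also have "\<dots> = (\<integral>\<^sup>+y. f y * ennreal (exp (\<rho> * (y - x) - \<gamma> * \<bar>y - x\<bar>) / \<gamma>) \<partial>lborel)"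
    using AE_lborel_singleton[of x]
  proof (intro nn_integral_cong_AE, eventually_elim)
    fix y assume "y \<noteq> x"
    have "(\<integral>\<^sup>+r. ennreal (indicator {0<..} r * exp (- \<kappa> * r)) * (f y * ennreal (normal_density (x + \<rho> * r) (sqrt r) y)) \<partial>lborel)
       = (\<integral>\<^sup>+r. f y * (ennreal (indicator {0<..} r * exp (- \<kappa> * r)) * ennreal (normal_density (x + \<rho> * r) (sqrt r) y)) \<partial>lborel)"
      by (simp add: ac_simps)
    also have "\<dots> = f y * (\<integral>\<^sup>+r. ennreal (indicator {0<..} r * exp (- \<kappa> * r)) * ennreal (normal_density (x + \<rho> * r) (sqrt r) y) \<partial>lborel)"
      by (rule nn_integral_cmult) (unfold normal_density_def, measurable)
    also have "\<dots> = f y * ennreal (exp (\<rho> * (y - x) - \<gamma> * \<bar>y - x\<bar>) / \<gamma>)"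
      using \<open>y \<noteq> x\<close> assms(1) by (subst laplace_normal_density) (auto simp: \<gamma>_def)
    finally show "(\<integral>\<^sup>+r. ennreal (indicator {0<..} r * exp (- \<kappa> * r)) * (f y * ennreal (normal_density (x + \<rho> * r) (sqrt r) y)) \<partial>lborel) = f y * ennreal (exp (\<rho> * (y - x) - \<gamma> * \<bar>y - x\<bar>) / \<gamma>)" .
  qed
  finally show ?thesis .
qed

section \<open>Independence of increments from the past\<close>

text \<open>The time is rounded down to the grid of mesh \<open>1 / Suc n\<close>. The rounded
  process takes countably many time values and is therefore jointly measurable; by continuity it
  converges to the process itself.\<close>

lemma borel_measurable_continuous_process:
  fixes Y :: "real \<Rightarrow> 'a \<Rightarrow> real"
  assumes meas[measurable]: "\<And>t. Y t \<in> borel_measurable N"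
    and cont: "\<And>\<omega>. \<omega> \<in> space N \<Longrightarrow> continuous_on UNIV (\<lambda>t. Y t \<omega>)"
  shows "(\<lambda>x. Y (fst x) (snd x)) \<in> borel_measurable (borel \<Otimes>\<^sub>M N)"
proof (rule borel_measurable_LIMSEQ_real)
  let ?d = "\<lambda>n t. real_of_int \<lfloor>real (Suc n) * t\<rfloor> / real (Suc n)"
  fix x :: "real \<times> 'a" assume "x \<in> space (borel \<Otimes>\<^sub>M N)"
  then have x: "snd x \<in> space N" by (auto simp: space_pair_measure)
  have "(\<lambda>n. ?d n (fst x)) \<longlonglongrightarrow> fst x"
  proof (rule tendsto_sandwich[of "\<lambda>n. fst x - 1 / real (Suc n)" _ _ "\<lambda>n. fst x"])
    have "real (Suc n) * fst x - 1 \<le> real_of_int \<lfloor>real (Suc n) * fst x\<rfloor>"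
      "real_of_int \<lfloor>real (Suc n) * fst x\<rfloor> \<le> real (Suc n) * fst x" for n
      by linarith+
    then show "\<forall>\<^sub>F n in sequentially. fst x - 1 / real (Suc n) \<le> ?d n (fst x)"
      "\<forall>\<^sub>F n in sequentially. ?d n (fst x) \<le> fst x"
      by (auto intro!: always_eventually simp: pos_le_divide_eq pos_divide_le_eq right_diff_distrib mult.commute simp del: of_nat_Suc)
    show "(\<lambda>n. fst x - 1 / real (Suc n)) \<longlonglongrightarrow> fst x" by real_asymp
  qed simp
  moreover have "isCont (\<lambda>t. Y t (snd x)) (fst x)"
    using cont[OF x] by (simp add: continuous_on_eq_continuous_at)
  ultimately show "(\<lambda>n. Y (?d n (fst x)) (snd x)) \<longlonglongrightarrow> Y (fst x) (snd x)"
    by (rule isCont_tendsto_compose[rotated])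
next
  fix n :: nat
  have "(\<lambda>x. \<lfloor>real (Suc n) * fst x\<rfloor>) \<in> borel \<Otimes>\<^sub>M N \<rightarrow>\<^sub>M count_space UNIV"
    by measurable
  then show "(\<lambda>x. Y (real_of_int \<lfloor>real (Suc n) * fst x\<rfloor> / real (Suc n)) (snd x)) \<in> borel_measurable (borel \<Otimes>\<^sub>M N)"
    by (rule measurable_compose_countable[rotated]) measurable
qed

section \<open>The normalised motion, its natural filtration and the Markov property\<close>

context brownian_motion
begin

text \<open>Subtracting \<open>B 0\<close> makes every path start at 0 exactly, and freezing
  negative times makes every path continuous on the whole line.\<close>

definition W :: "real \<Rightarrow> 'a \<Rightarrow> real" where
  "W r \<omega> = B (max 0 r) \<omega> - B 0 \<omega>"

definition cylinders :: "real \<Rightarrow> 'a set set" where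
  "cylinders s = {{\<omega> \<in> space M. \<forall>r\<in>J. W r \<omega> \<in> C r} | J C. finite J \<and> J \<subseteq> {0..s} \<and> (\<forall>r. C r \<in> sets borel)}"

definition past :: "real \<Rightarrow> 'a measure" where
  "past s = sigma (space M) (cylinders s)"

lemma W_0 [simp]: "W 0 \<omega> = 0"
  by (simp add: W_def)

lemma measurable_W [measurable]: "W r \<in> borel_measurable M"
  unfolding W_def using random_variable[of "max 0 r"] random_variable[of 0] by measurable

lemma continuous_W: "\<omega> \<in> space M \<Longrightarrow> continuous_on UNIV (\<lambda>r. W r \<omega>)"
  unfolding W_def
  by (intro continuous_intros continuous_on_compose2[OF continuous_paths, where f="\<lambda>r. max 0 r"]) auto

lemma cylinders_Pow: "cylinders s \<subseteq> Pow (space M)"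
  by (auto simp: cylinders_def)

lemma space_past [simp]: "space (past s) = space M"
  by (simp add: past_def space_measure_of[OF cylinders_Pow])

lemma sets_past: "sets (past s) = sigma_sets (space M) (cylinders s)"
  by (simp add: past_def sets_measure_of[OF cylinders_Pow])

lemma measurable_W_past:
  assumes "0 \<le> r" "r \<le> s"
  shows "W r \<in> borel_measurable (past s)"
proof (rule measurableI)
  fix C :: "real set" assume "C \<in> sets borel"
  then have "W r -` C \<inter> space M \<in> cylinders s"
    unfolding cylinders_def using assms
    by (intro CollectI exI[of _ "{r}"] exI[of _ "\<lambda>_. C"]) auto
  then show "W r -` C \<inter> space (past s) \<in> sets (past s)"
    by (auto simp: sets_past)
qed simp

lemma cylinders_events: "cylinders s \<subseteq> events"
proof
  fix a assume "a \<in> cylinders s"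
  then obtain J C where a: "a = {\<omega> \<in> space M. \<forall>r\<in>J. W r \<omega> \<in> C r}" "finite J" "\<forall>r. C r \<in> sets borel"
    by (auto simp: cylinders_def)
  have "W r -` C r \<inter> space M \<in> events" for r
    using a(3) by (intro measurable_sets[of _ _ borel]) auto
  then have "{\<omega> \<in> space M. W r \<omega> \<in> C r} \<in> events" for r
    by (simp add: vimage_def Collect_conj_eq[symmetric] Int_def conj_commute)
  then show "a \<in> events" unfolding a using a(2) by (intro sets.sets_Collect_finite_All) auto
qed

lemma Int_stable_cylinders: "Int_stable (cylinders s)"
proof (rule Int_stableI)
  fix a b assume "a \<in> cylinders s" "b \<in> cylinders s"
  then obtain J C J' C' where a: "a = {\<omega> \<in> space M. \<forall>r\<in>J. W r \<omega> \<in> C r}" "finite J" "J \<subseteq> {0..s}" "\<forall>r. C r \<in> sets borel"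
    and b: "b = {\<omega> \<in> space M. \<forall>r\<in>J'. W r \<omega> \<in> C' r}" "finite J'" "J' \<subseteq> {0..s}" "\<forall>r. C' r \<in> sets borel"
    by (auto simp: cylinders_def)
  let ?D = "\<lambda>r. (if r \<in> J then C r else UNIV) \<inter> (if r \<in> J' then C' r else UNIV)"
  have "a \<inter> b = {\<omega> \<in> space M. \<forall>r\<in>J \<union> J'. W r \<omega> \<in> ?D r}"
    unfolding a b by auto
  then show "a \<inter> b \<in> cylinders s"
    unfolding cylinders_def using a b
    by (intro CollectI exI[of _ "J \<union> J'"] exI[of _ ?D]) auto
qed

text \<open>Along a grid containing 0 and \<open>s\<close>, the values of \<open>W\<close> are
  partial sums of the increments up to \<open>s\<close>, and \<open>B t - B s\<close> is one further
  increment. Independence of disjoint blocks of increments then separates the two events.\<close>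

lemma prob_cylinder_increment:
  assumes a: "a \<in> cylinders s" and s: "0 \<le> s" "s < t" and C': "C' \<in> sets borel"
  shows "prob (a \<inter> ((\<lambda>\<omega>. B t \<omega> - B s \<omega>) -` C' \<inter> space M)) = prob a * prob ((\<lambda>\<omega>. B t \<omega> - B s \<omega>) -` C' \<inter> space M)"
proof -
  obtain J C where J: "a = {\<omega> \<in> space M. \<forall>r\<in>J. W r \<omega> \<in> C r}" "finite J" "J \<subseteq> {0..s}" "\<And>r. C r \<in> sets borel"
    using a by (auto simp: cylinders_def)
  \<comment> \<open>With 0 in the grid, \<open>W\<close> is a sum of increments alone; with
    \<open>s\<close> in it, the step after the last grid point is exactly the one from
    \<open>s\<close> to \<open>t\<close>.\<close>
  define K where "K = insert 0 (insert s J)"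
  have K: "finite K" "K \<subseteq> {0..s}" "0 \<in> K" "s \<in> K" using J s by (auto simp: K_def)
  define xs where "xs = sorted_list_of_set K"
  define n where "n = card K - 1"
  have len: "length xs = Suc n"
    using K card_gt_0_iff[of K] by (auto simp: xs_def n_def)
  have set: "set xs = K" and sorted: "sorted_wrt (<) xs"
    using K by (auto simp: xs_def)
  \<comment> \<open>The grid points are \<open>\<tau> 0\<close> to \<open>\<tau> n\<close>, and
    \<open>\<tau> (Suc n) = t\<close>. Thus there are \<open>Suc n\<close> increments, and number
    \<open>n\<close> is \<open>B t - B s\<close>.\<close>
  define \<tau> where "\<tau> i = (if i \<le> n then xs ! i else t)" for i
  have \<tau>_mono: "\<tau> i < \<tau> j" if "i < j" "j \<le> n" for i j
    using that sorted len by (auto simp: \<tau>_def sorted_wrt_iff_nth_less)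
  have \<tau>_K: "K = \<tau> ` {..n}"
    unfolding set[symmetric] \<tau>_def using len by (auto simp: in_set_conv_nth image_iff less_Suc_eq_le Bex_def)
  have \<tau>_in: "0 \<le> \<tau> i" "\<tau> i \<le> s" if "i \<le> n" for i
    using \<tau>_K K(2) that by auto
  have \<tau>_0: "\<tau> 0 = 0"
  proof -
    obtain i where "i \<le> n" "\<tau> i = 0" using K(3) \<tau>_K by auto
    then show ?thesis using \<tau>_mono[of 0 i] \<tau>_in[of 0] by (cases "i = 0") auto
  qed
  have \<tau>_n: "\<tau> n = s"
  proof -
    obtain i where "i \<le> n" "\<tau> i = s" using K(4) \<tau>_K by auto
    then show ?thesis using \<tau>_mono[of i n] \<tau>_in[of n] by (cases "i = n") auto
  qed
  have \<tau>_Suc: "\<tau> i < \<tau> (Suc i)" if "i < Suc n" for i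
    using that \<tau>_mono[of i "Suc i"] \<tau>_n s by (cases "i = n") (auto simp: \<tau>_def)
  define \<Delta> where "\<Delta> i \<omega> = B (\<tau> (Suc i)) \<omega> - B (\<tau> i) \<omega>" for i \<omega>
  have ind: "indep_vars (\<lambda>_. borel) \<Delta> {..<Suc n}"
    unfolding \<Delta>_def by (rule indep_increments) (use \<tau>_0 \<tau>_Suc in auto)
  have \<Delta>_n: "\<Delta> n = (\<lambda>\<omega>. B t \<omega> - B s \<omega>)" by (simp add: \<Delta>_def \<tau>_n fun_eq_iff) (simp add: \<tau>_def)
  have W_sum: "W (\<tau> i) \<omega> = (\<Sum>j<i. \<Delta> j \<omega>)" if "i \<le> n" for i \<omega>
    using sum_lessThan_telescope[of "\<lambda>i. B (\<tau> i) \<omega>" i] \<tau>_in[OF that] \<tau>_0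
    by (simp add: W_def \<Delta>_def max_def)
  have iv: "indep_var (PiM {..<n} (\<lambda>_. borel)) (\<lambda>\<omega>. restrict (\<lambda>i. \<Delta> i \<omega>) {..<n})
      (PiM {n} (\<lambda>_. borel)) (\<lambda>\<omega>. restrict (\<lambda>i. \<Delta> i \<omega>) {n})"
    by (rule indep_var_restrict[OF ind]) auto
  let ?P = "PiM {..<n} (\<lambda>_. borel :: real measure)"
  define A1 where "A1 = {f \<in> space ?P. \<forall>i\<in>{i. i \<le> n \<and> \<tau> i \<in> J}. (\<Sum>j<i. f j) \<in> C (\<tau> i)}"
  have "A1 \<in> sets ?P"
    unfolding A1_def
  proof (rule sets.sets_Collect_finite_All)
    fix i assume i: "i \<in> {i. i \<le> n \<and> \<tau> i \<in> J}"
    have "(\<lambda>f. \<Sum>j<i. f j) \<in> borel_measurable ?P"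
      using i by (intro borel_measurable_sum measurable_component_singleton) auto
    from measurable_sets[OF this J(4)[of "\<tau> i"]]
    have "(\<lambda>f. \<Sum>j<i. f j) -` C (\<tau> i) \<inter> space ?P \<in> sets ?P" .
    also have "(\<lambda>f. \<Sum>j<i. f j) -` C (\<tau> i) \<inter> space ?P = {f \<in> space ?P. (\<Sum>j<i. f j) \<in> C (\<tau> i)}" by auto
    finally show "{f \<in> space ?P. (\<Sum>j<i. f j) \<in> C (\<tau> i)} \<in> sets ?P" .
  qed simp
  moreover have "{f \<in> space (PiM {n} (\<lambda>_. borel :: real measure)). f n \<in> C'} \<in> sets (PiM {n} (\<lambda>_. borel))"
    using C' measurable_sets[OF measurable_component_singleton[of n "{n}" "\<lambda>_. borel"], of C']
    by (simp add: vimage_def Int_def conj_commute)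
  ultimately have eq: "prob ((\<lambda>\<omega>. (restrict (\<lambda>i. \<Delta> i \<omega>) {..<n}, restrict (\<lambda>i. \<Delta> i \<omega>) {n})) -` (A1 \<times> {f \<in> space (PiM {n} (\<lambda>_. borel)). f n \<in> C'}) \<inter> space M)
      = prob ((\<lambda>\<omega>. restrict (\<lambda>i. \<Delta> i \<omega>) {..<n}) -` A1 \<inter> space M) * prob ((\<lambda>\<omega>. restrict (\<lambda>i. \<Delta> i \<omega>) {n}) -` {f \<in> space (PiM {n} (\<lambda>_. borel)). f n \<in> C'} \<inter> space M)"
    by (rule indep_varD[OF iv])
  have J_ball: "(\<forall>r\<in>J. Q r) \<longleftrightarrow> (\<forall>i\<in>{i. i \<le> n \<and> \<tau> i \<in> J}. Q (\<tau> i))" for Q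
  proof -
    have "x \<in> \<tau> ` {..n}" if "x \<in> J" for x
      using that unfolding \<tau>_K[symmetric] K_def by simp
    then show ?thesis by fastforce
  qed
  have "(\<lambda>\<omega>. restrict (\<lambda>i. \<Delta> i \<omega>) {..<n}) -` A1 \<inter> space M = a"
    unfolding A1_def J(1) J_ball by (auto simp: space_PiM W_sum)
  moreover have "(\<lambda>\<omega>. restrict (\<lambda>i. \<Delta> i \<omega>) {n}) -` {f \<in> space (PiM {n} (\<lambda>_. borel)). f n \<in> C'} \<inter> space M = (\<lambda>\<omega>. B t \<omega> - B s \<omega>) -` C' \<inter> space M"
    by (auto simp: space_PiM \<Delta>_n)
  moreover have "(\<lambda>\<omega>. (restrict (\<lambda>i. \<Delta> i \<omega>) {..<n}, restrict (\<lambda>i. \<Delta> i \<omega>) {n})) -` (A1 \<times> {f \<in> space (PiM {n} (\<lambda>_. borel)). f n \<in> C'}) \<inter> space M =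
     ((\<lambda>\<omega>. restrict (\<lambda>i. \<Delta> i \<omega>) {..<n}) -` A1 \<inter> space M) \<inter> ((\<lambda>\<omega>. restrict (\<lambda>i. \<Delta> i \<omega>) {n}) -` {f \<in> space (PiM {n} (\<lambda>_. borel)). f n \<in> C'} \<inter> space M)"
    by auto
  ultimately show ?thesis using eq by simp
qed

text \<open>Finite-dimensional cylinders form an intersection-stable generator of the past, so
  independence extends from them to the whole sigma-algebra. Stated as an identity of product laws,
  it allows the increment to be integrated out by Tonelli.\<close>

lemma indep_past_increment:
  assumes "0 \<le> s" "s < t"
  shows "(\<lambda>\<omega>. \<omega>) \<in> M \<rightarrow>\<^sub>M past s"
    and "distr M (past s) (\<lambda>\<omega>. \<omega>) \<Otimes>\<^sub>M distr M borel (\<lambda>\<omega>. B t \<omega> - B s \<omega>) =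
      distr M (past s \<Otimes>\<^sub>M borel) (\<lambda>\<omega>. (\<omega>, B t \<omega> - B s \<omega>))"
proof -
  let ?D = "\<lambda>\<omega>. B t \<omega> - B s \<omega>"
  let ?G = "{?D -` C \<inter> space M | C. C \<in> sets borel}"
  have D[measurable]: "?D \<in> borel_measurable M"
    using assms by (intro borel_measurable_diff random_variable) auto
  have past: "sets (past s) \<subseteq> events"
    unfolding sets_past using cylinders_events by (rule sets.sigma_sets_subset)
  have "indep_set (cylinders s) ?G"
  proof (rule indep_setI)
    show "?G \<subseteq> events" by (auto intro: measurable_sets[OF D])
    fix a b assume "a \<in> cylinders s" "b \<in> ?G"
    then show "prob (a \<inter> b) = prob a * prob b"
      using prob_cylinder_increment assms by blast
  qed (rule cylinders_events)
  moreover have "Int_stable ?G"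
  proof (rule Int_stableI)
    fix a b assume "a \<in> ?G" "b \<in> ?G"
    then obtain C C' where "a = ?D -` C \<inter> space M" "b = ?D -` C' \<inter> space M" "C \<in> sets borel" "C' \<in> sets borel" by auto
    then show "a \<inter> b \<in> ?G" by (intro CollectI exI[of _ "C \<inter> C'"]) auto
  qed
  ultimately have "indep_set (sigma_sets (space M) (cylinders s)) (sigma_sets (space M) ?G)"
    by (intro indep_set_sigma_sets Int_stable_cylinders)
  then have indep: "prob (A \<inter> (?D -` C \<inter> space M)) = prob A * prob (?D -` C \<inter> space M)"
    if "A \<in> sets (past s)" "C \<in> sets borel" for A C
    using that by (intro indep_setD) (auto simp: sets_past)
  show id[measurable]: "(\<lambda>\<omega>. \<omega>) \<in> M \<rightarrow>\<^sub>M past s"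
    using past by (intro measurableI) (auto simp: sets.Int_space_eq2)
  interpret D: prob_space "distr M borel ?D" by (rule prob_space_distr[OF D])
  interpret P: prob_space "distr M (past s) (\<lambda>\<omega>. \<omega>)" by (rule prob_space_distr[OF id])
  show "distr M (past s) (\<lambda>\<omega>. \<omega>) \<Otimes>\<^sub>M distr M borel ?D = distr M (past s \<Otimes>\<^sub>M borel) (\<lambda>\<omega>. (\<omega>, ?D \<omega>))"
  proof (rule pair_measure_eqI)
    fix A C assume "A \<in> sets (distr M (past s) (\<lambda>\<omega>. \<omega>))" "C \<in> sets (distr M borel ?D)"
    then have AC[measurable]: "A \<in> sets (past s)" "C \<in> sets borel" by auto
    have A: "A \<inter> space M = A" using sets.sets_into_space[OF AC(1)] by auto
    have "(\<lambda>\<omega>. (\<omega>, ?D \<omega>)) -` (A \<times> C) \<inter> space M = A \<inter> (?D -` C \<inter> space M)" using A by auto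
    then have "emeasure (distr M (past s \<Otimes>\<^sub>M borel) (\<lambda>\<omega>. (\<omega>, ?D \<omega>))) (A \<times> C) = prob (A \<inter> (?D -` C \<inter> space M))"
      by (subst emeasure_distr) (auto simp: emeasure_eq_measure intro!: measurable_Pair)
    then show "emeasure (distr M (past s) (\<lambda>\<omega>. \<omega>)) A * emeasure (distr M borel ?D) C =
        emeasure (distr M (past s \<Otimes>\<^sub>M borel) (\<lambda>\<omega>. (\<omega>, ?D \<omega>))) (A \<times> C)"
      using A by (simp add: indep[OF AC] emeasure_distr emeasure_eq_measure ennreal_mult)
  qed (auto simp: P.sigma_finite_measure_axioms D.sigma_finite_measure_axioms cong: sets_pair_measure_cong)
qed

lemma nn_integral_past_increment:
  assumes s: "0 \<le> s" "s < t"
    and g[measurable]: "g \<in> borel_measurable (past s)" and X[measurable]: "X \<in> borel_measurable (past s)"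
    and f[measurable]: "f \<in> borel_measurable borel"
  shows "(\<integral>\<^sup>+\<omega>. g \<omega> * f (X \<omega> + (B t \<omega> - B s \<omega>)) \<partial>M)
     = (\<integral>\<^sup>+\<omega>. g \<omega> * (\<integral>\<^sup>+y. f y * ennreal (normal_density (X \<omega>) (sqrt (t - s)) y) \<partial>lborel) \<partial>M)"
proof -
  let ?D = "\<lambda>\<omega>. B t \<omega> - B s \<omega>"
  note id[measurable] = indep_past_increment(1)[OF s] and eq = indep_past_increment(2)[OF s]
  have D[measurable]: "?D \<in> borel_measurable M"
    using s by (intro borel_measurable_diff random_variable) auto
  have distrD: "distr M borel ?D = density lborel (normal_density 0 (sqrt (t - s)))"
    using distributed_distr_eq_density[OF normal_increments[OF s]] distr_cong[OF refl sets_lborel refl] by metis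
  interpret D: prob_space "distr M borel ?D" by (rule prob_space_distr[OF D])
  have "(\<integral>\<^sup>+\<omega>. g \<omega> * f (X \<omega> + ?D \<omega>) \<partial>M) = (\<integral>\<^sup>+p. g (fst p) * f (X (fst p) + snd p) \<partial>distr M (past s \<Otimes>\<^sub>M borel) (\<lambda>\<omega>. (\<omega>, ?D \<omega>)))"
    by (subst nn_integral_distr) (auto intro!: measurable_Pair)
  also have "\<dots> = (\<integral>\<^sup>+\<omega>. \<integral>\<^sup>+d. g \<omega> * f (X \<omega> + d) \<partial>distr M borel ?D \<partial>distr M (past s) (\<lambda>\<omega>. \<omega>))"
    unfolding eq[symmetric] by (subst D.nn_integral_fst[symmetric]) (simp_all, measurable)
  also have "\<dots> = (\<integral>\<^sup>+\<omega>. \<integral>\<^sup>+d. g \<omega> * f (X \<omega> + d) \<partial>distr M borel ?D \<partial>M)"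
    by (subst nn_integral_distr) (auto intro!: D.borel_measurable_nn_integral)
  also have "\<dots> = (\<integral>\<^sup>+\<omega>. g \<omega> * (\<integral>\<^sup>+y. f y * ennreal (normal_density (X \<omega>) (sqrt (t - s)) y) \<partial>lborel) \<partial>M)"
  proof (rule nn_integral_cong)
    fix \<omega>
    have "(\<integral>\<^sup>+d. g \<omega> * f (X \<omega> + d) \<partial>distr M borel ?D) = (\<integral>\<^sup>+d. g \<omega> * (f (X \<omega> + d) * ennreal (normal_density 0 (sqrt (t - s)) d)) \<partial>lborel)"
      unfolding distrD by (subst nn_integral_density) (auto simp: ac_simps)
    also have "\<dots> = g \<omega> * (\<integral>\<^sup>+d. f (X \<omega> + d) * ennreal (normal_density 0 (sqrt (t - s)) d) \<partial>lborel)"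
      by (rule nn_integral_cmult) simp
    also have "(\<integral>\<^sup>+d. f (X \<omega> + d) * ennreal (normal_density 0 (sqrt (t - s)) d) \<partial>lborel) = (\<integral>\<^sup>+d. f (X \<omega> + 1 * d) * ennreal (normal_density (X \<omega>) (sqrt (t - s)) (X \<omega> + 1 * d)) \<partial>lborel)"
      by (simp add: normal_density_def)
    also have "\<dots> = (\<integral>\<^sup>+y. f y * ennreal (normal_density (X \<omega>) (sqrt (t - s)) y) \<partial>lborel)"
      by (subst nn_integral_real_affine[where c=1 and t="X \<omega>"]) simp_all
    finally show "(\<integral>\<^sup>+d. g \<omega> * f (X \<omega> + d) \<partial>distr M borel ?D) = g \<omega> * (\<integral>\<^sup>+y. f y * ennreal (normal_density (X \<omega>) (sqrt (t - s)) y) \<partial>lborel)" .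
  qed
  finally show ?thesis .
qed

end

section \<open>The Kac equation for the sojourn time\<close>

text \<open>The primitive \<open>A\<close> of \<open>h\<close> need not be differentiable where \<open>h\<close> is discontinuous, but the left-hand
  side has increments of order \<open>(b - a)\<^sup>2\<close>, hence derivative \<open>0\<close> everywhere.\<close>

lemma exp_primitive_identity:
  fixes h :: "real \<Rightarrow> real" and \<mu> t :: real
  assumes h[measurable]: "h \<in> borel_measurable borel" and h01: "\<And>s. 0 \<le> h s" "\<And>s. h s \<le> 1"
    and \<mu>: "0 \<le> \<mu>" and t: "0 \<le> t"
  defines "A \<equiv> \<lambda>t. LBINT s:{0..t}. h s"
  shows "exp (- \<mu> * A t) + \<mu> * (LBINT s:{0..t}. h s * exp (- \<mu> * A s)) = 1"
proof -
  have int: "set_integrable lborel {a..b} g"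
    if [measurable]: "g \<in> borel_measurable borel" and "\<And>s. norm (g s) \<le> 1" for g :: "real \<Rightarrow> real" and a b
    unfolding set_integrable_def
    by (rule integrableI_bounded_set_indicator[where B=1]) (use that in \<open>auto intro: AE_I2 simp: emeasure_lborel_Icc_eq\<close>)
  have split: "(LBINT s:{0..b}. g s) = (LBINT s:{0..a}. g s) + (LBINT s:{a..b}. g s)"
    if g: "g \<in> borel_measurable borel" "\<And>s. norm (g s) \<le> 1" and ab: "0 \<le> a" "a \<le> b" for g :: "real \<Rightarrow> real" and a b
  proof -
    have "set_integrable lborel {0<..<b} g"
      by (rule set_integrable_subset[OF int[OF g, of 0 b]]) auto
    then show ?thesis
      using interval_integral_sum[of 0 a b g] ab
      by (simp add: interval_integral_Icc interval_lebesgue_integrable_def min_def max_def zero_ereal_def)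
  qed
  have hn: "norm (h s) \<le> 1" for s using h01[of s] by simp
  have A_diff: "A b - A a = (LBINT s:{a..b}. h s)" if "0 \<le> a" "a \<le> b" for a b
    unfolding A_def using split[OF h hn that] by simp
  have A_mono: "A a \<le> A b" if "a \<le> b" for a b
    unfolding A_def set_lebesgue_integral_def
    using int[OF h hn] that h01
    by (intro integral_mono) (auto simp: set_integrable_def split: split_indicator)
  have A_nonneg: "0 \<le> A a" for a
    unfolding A_def set_lebesgue_integral_def using h01 by (intro integral_nonneg_AE) auto
  have A_lip: "A b - A a \<le> b - a" if "0 \<le> a" "a \<le> b" for a b
  proof -
    have "(LBINT s:{a..b}. h s) \<le> (LBINT s:{a..b}. 1)"
      by (rule set_integral_mono) (use int[OF h hn] int[of "\<lambda>_. 1"] h01 in auto)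
    then show ?thesis using A_diff[OF that] that by (simp add: set_lebesgue_integral_def)
  qed
  have A_meas[measurable]: "A \<in> borel_measurable borel"
    by (rule borel_measurable_mono) (auto intro: A_mono monoI)
  define g where "g s = h s * exp (- \<mu> * A s)" for s
  have g_meas[measurable]: "g \<in> borel_measurable borel" unfolding g_def by measurable
  have g_norm: "norm (g s) \<le> 1" for s
    unfolding g_def using h01[of s] A_nonneg[of s] \<mu> by (auto simp: abs_mult intro!: mult_le_one)
  define D where "D t = exp (- \<mu> * A t) + \<mu> * (LBINT s:{0..t}. g s)" for t
  have D_bound: "\<bar>D b - D a\<bar> \<le> \<mu>\<^sup>2 * (b - a)\<^sup>2" if ab: "0 \<le> a" "a \<le> b" for a b
  proof -
    define I where "I = (LBINT s:{a..b}. g s)"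
    define E where "E s = exp (- \<mu> * A s)" for s
    let ?\<Delta> = "A b - A a"
    have E_mono: "E b \<le> E s" "E s \<le> E a" if "a \<le> s" "s \<le> b" for s
      unfolding E_def using A_mono that \<mu> by (auto intro!: mult_left_mono)
    have Eh: "set_integrable lborel {a..b} (\<lambda>s. e * h s)" for e
      using int[OF h hn, of a b] by (rule set_integrable_mult_right)
    have ig: "set_integrable lborel {a..b} g" by (rule int[OF g_meas g_norm])
    have gE: "g s = E s * h s" for s by (simp add: g_def E_def)
    have bounds: "E b * h s \<le> g s" "g s \<le> E a * h s" if "s \<in> {a..b}" for s
      unfolding gE using that E_mono[of s] h01 by (auto intro!: mult_right_mono)
    have "(LBINT s:{a..b}. E b * h s) \<le> I" "I \<le> (LBINT s:{a..b}. E a * h s)"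
      unfolding I_def by (rule set_integral_mono[OF Eh ig bounds(1)], assumption) (rule set_integral_mono[OF ig Eh bounds(2)], assumption)
    then have I: "E b * ?\<Delta> \<le> I" "I \<le> E a * ?\<Delta>"
      using A_diff[OF ab] by simp_all
    have \<Delta>: "0 \<le> ?\<Delta>" "?\<Delta> \<le> b - a" using A_mono[OF ab(2)] A_lip[OF ab] by auto
    have "1 + \<mu> * ?\<Delta> \<le> exp (\<mu> * ?\<Delta>)" "1 + (- \<mu> * ?\<Delta>) \<le> exp (- \<mu> * ?\<Delta>)"
      by (rule exp_ge_add_one_self)+
    then have "E b * (1 + \<mu> * ?\<Delta>) \<le> E b * exp (\<mu> * ?\<Delta>)" "E a * (1 + (- \<mu> * ?\<Delta>)) \<le> E a * exp (- \<mu> * ?\<Delta>)"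
      by (auto intro!: mult_left_mono simp: E_def)
    moreover have "E b * exp (\<mu> * ?\<Delta>) = E a" "E a * exp (- \<mu> * ?\<Delta>) = E b"
      by (auto simp: E_def exp_add[symmetric] algebra_simps)
    \<comment> \<open>Both \<open>E a - E b\<close> and \<open>\<mu> * I\<close> lie between
      \<open>E b * (\<mu> * ?\<Delta>)\<close> and \<open>E a * (\<mu> * ?\<Delta>)\<close>. Their
      difference, the increment of \<open>D\<close> up to sign, is thus at most the length of that
      interval, which is itself at most the square of \<open>\<mu> * ?\<Delta>\<close>.\<close>
    ultimately have E: "E b * (\<mu> * ?\<Delta>) \<le> E a - E b" "E a - E b \<le> E a * (\<mu> * ?\<Delta>)"
      by (auto simp: algebra_simps)
    have \<mu>I: "E b * (\<mu> * ?\<Delta>) \<le> \<mu> * I" "\<mu> * I \<le> E a * (\<mu> * ?\<Delta>)"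
      using mult_left_mono[OF I(1) \<mu>] mult_left_mono[OF I(2) \<mu>] by (auto simp: algebra_simps)
    have "D b - D a = E b - E a + \<mu> * I"
      unfolding D_def E_def I_def split[OF g_meas g_norm ab] by (simp add: algebra_simps)
    then have "\<bar>D b - D a\<bar> \<le> (E a - E b) * (\<mu> * ?\<Delta>)"
      using E \<mu>I by (simp add: abs_le_iff algebra_simps)
    also have "\<dots> \<le> (\<mu> * ?\<Delta>) * (\<mu> * ?\<Delta>)"
    proof (rule mult_right_mono)
      have "E a * (\<mu> * ?\<Delta>) \<le> 1 * (\<mu> * ?\<Delta>)"
        using \<Delta> \<mu> A_nonneg[of a] by (intro mult_right_mono) (auto simp: E_def)
      then show "E a - E b \<le> \<mu> * ?\<Delta>" using E by simp
    qed (use \<mu> \<Delta> in auto)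
    also have "\<dots> = \<mu>\<^sup>2 * ?\<Delta>\<^sup>2" by (simp add: power2_eq_square algebra_simps)
    also have "\<dots> \<le> \<mu>\<^sup>2 * (b - a)\<^sup>2"
      using \<Delta> by (intro mult_left_mono power_mono) auto
    finally show ?thesis .
  qed
  have D_bound': "\<bar>D b - D a\<bar> \<le> \<mu>\<^sup>2 * (b - a)\<^sup>2" if "0 \<le> a" "0 \<le> b" for a b
    using D_bound[of a b] D_bound[of b a] that
    by (cases "a \<le> b") (auto simp: abs_minus_commute power2_commute)
  have "(D has_field_derivative 0) (at x within {0..})" if x: "x \<in> {0..}" for x
    unfolding has_field_derivative_iff
  proof (rule Lim_null_comparison)
    show "\<forall>\<^sub>F y in at x within {0..}. norm ((D y - D x) / (y - x)) \<le> \<mu>\<^sup>2 * \<bar>y - x\<bar>"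
      unfolding eventually_at_filter
    proof (intro always_eventually allI impI)
      fix y assume "y \<noteq> x" "y \<in> {0..}"
      then show "norm ((D y - D x) / (y - x)) \<le> \<mu>\<^sup>2 * \<bar>y - x\<bar>"
        using D_bound'[of x y] x
        by (simp add: divide_le_eq mult.assoc power2_eq_square[of "y - x"] flip: abs_mult)
    qed
    have "((\<lambda>y. \<mu>\<^sup>2 * \<bar>y - x\<bar>) \<longlongrightarrow> \<mu>\<^sup>2 * \<bar>x - x\<bar>) (at x within {0..})"
      by (intro tendsto_intros)
    then show "((\<lambda>y. \<mu>\<^sup>2 * \<bar>y - x\<bar>) \<longlongrightarrow> 0) (at x within {0..})" by simp
  qed
  then obtain c where "\<And>x. x \<in> {0..} \<Longrightarrow> D x = c"
    using has_field_derivative_zero_constant[of "{0..}" D] by blast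
  then have "D t = D 0" using t by simp
  also have "D 0 = 1"
  proof -
    have "(LBINT s:{0..0}. k s) = 0" for k :: "real \<Rightarrow> real"
      using AE_lborel_singleton[of "0::real"]
      unfolding set_lebesgue_integral_def by (intro integral_eq_zero_AE) auto
    then show ?thesis unfolding D_def A_def by simp
  qed
  finally show ?thesis unfolding D_def g_def .
qed

section \<open>The drifted motion, its sojourn time and the Kac equation\<close>

context brownian_motion
begin

definition drifted :: "real \<Rightarrow> real \<Rightarrow> 'a \<Rightarrow> real" where
  "drifted \<rho> r \<omega> = W r \<omega> + \<rho> * max 0 r"

lemma drifted_0 [simp]: "drifted \<rho> 0 \<omega> = 0"
  by (simp add: drifted_def)

lemma continuous_drifted: "\<omega> \<in> space M \<Longrightarrow> continuous_on UNIV (\<lambda>r. drifted \<rho> r \<omega>)"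
  unfolding drifted_def by (intro continuous_intros continuous_W)

lemma measurable_drifted_past: "0 \<le> r \<Longrightarrow> r \<le> s \<Longrightarrow> drifted \<rho> r \<in> borel_measurable (past s)"
  unfolding drifted_def by (intro borel_measurable_add borel_measurable_const measurable_W_past)

lemma measurable_drifted_pair: "(\<lambda>x. drifted \<rho> (fst x) (snd x)) \<in> borel_measurable (borel \<Otimes>\<^sub>M M)"
  by (rule borel_measurable_continuous_process) (simp_all add: continuous_drifted, simp add: drifted_def)

lemma measurable_drifted [measurable (raw)]:
  assumes [measurable]: "g \<in> borel_measurable N" "h \<in> N \<rightarrow>\<^sub>M M"
  shows "(\<lambda>x. drifted \<rho> (g x) (h x)) \<in> borel_measurable N"
  using measurable_compose[OF _ measurable_drifted_pair, of "\<lambda>x. (g x, h x)" N \<rho>] by simp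

lemma measurable_sojourn [measurable (raw)]:
  assumes [measurable]: "g \<in> borel_measurable N" "h \<in> N \<rightarrow>\<^sub>M M"
  shows "(\<lambda>x. sojourn_time (drifted \<rho>) (g x) (h x)) \<in> borel_measurable N"
proof -
  have "(\<lambda>x. sojourn_time (drifted \<rho>) (g x) (h x)) =
    (\<lambda>x. \<integral>s. (if 0 \<le> s \<and> s \<le> g x then indicator {0..} (drifted \<rho> s (h x)) else 0) \<partial>lborel)"
    unfolding sojourn_time_def set_lebesgue_integral_def
    by (intro ext Bochner_Integration.integral_cong) (auto split: split_indicator)
  also have "\<dots> \<in> borel_measurable N" by measurable
  finally show ?thesis .
qed

text \<open>Clamping the time to [0, \<open>s\<close>] leaves the sojourn time up to
  \<open>s\<close> unchanged and makes the process continuous and measurable for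
  \<open>past s\<close> at every time. Joint measurability then follows with respect to
  \<open>past s\<close> instead of \<open>M\<close>.\<close>

lemma measurable_sojourn_past:
  assumes s: "0 \<le> s"
  shows "sojourn_time (drifted \<rho>) s \<in> borel_measurable (past s)"
proof -
  let ?Y = "\<lambda>r. drifted \<rho> (max 0 (min r s))"
  have "(\<lambda>x. ?Y (fst x) (snd x)) \<in> borel_measurable (borel \<Otimes>\<^sub>M past s)"
  proof (rule borel_measurable_continuous_process)
    show "?Y r \<in> borel_measurable (past s)" for r
      using s by (intro measurable_drifted_past) auto
    fix \<omega> assume "\<omega> \<in> space (past s)"
    then show "continuous_on UNIV (\<lambda>r. ?Y r \<omega>)"
      by (intro continuous_on_compose2[OF continuous_drifted, where f="\<lambda>r. max 0 (min r s)"] continuous_intros) auto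
  qed
  then have "(\<lambda>x. (\<lambda>x. ?Y (fst x) (snd x)) (snd x, fst x)) \<in> borel_measurable (past s \<Otimes>\<^sub>M borel)"
    by (rule measurable_compose[rotated]) simp
  then have [measurable]: "(\<lambda>x. ?Y (snd x) (fst x)) \<in> borel_measurable (past s \<Otimes>\<^sub>M borel)" by simp
  have "sojourn_time (drifted \<rho>) s = (\<lambda>\<omega>. \<integral>r. indicator {0..s} r *\<^sub>R indicator {0..} (?Y r \<omega>) \<partial>lborel)"
    unfolding sojourn_time_def set_lebesgue_integral_def
    by (intro ext Bochner_Integration.integral_cong) (auto split: split_indicator simp: min_def max_def)
  also have "\<dots> \<in> borel_measurable (past s)"
    by measurable
  finally show ?thesis .
qed

lemma nn_integral_drifted_markov:
  assumes s: "0 \<le> s" "s < t"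
    and g: "g \<in> borel_measurable (past s)" and f: "f \<in> borel_measurable borel"
  shows "(\<integral>\<^sup>+\<omega>. g \<omega> * f (drifted \<rho> t \<omega>) \<partial>M) = (\<integral>\<^sup>+\<omega>. g \<omega> * drift_semigroup \<rho> f (t - s) (drifted \<rho> s \<omega>) \<partial>M)"
proof -
  have "drifted \<rho> t \<omega> = (drifted \<rho> s \<omega> + \<rho> * (t - s)) + (B t \<omega> - B s \<omega>)" for \<omega>
    using s by (simp add: drifted_def W_def algebra_simps)
  moreover have "(\<lambda>\<omega>. drifted \<rho> s \<omega> + \<rho> * (t - s)) \<in> borel_measurable (past s)"
    using s by (intro borel_measurable_add borel_measurable_const measurable_drifted_past) auto
  ultimately show ?thesis
    using nn_integral_past_increment[OF s g _ f, of "\<lambda>\<omega>. drifted \<rho> s \<omega> + \<rho> * (t - s)"]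
    by (simp add: drift_semigroup_def)
qed

lemma sojourn_nonneg: "0 \<le> sojourn_time Y t \<omega>"
  unfolding sojourn_time_def set_lebesgue_integral_def by (intro integral_nonneg_AE) auto

lemma exp_sojourn_identity:
  assumes \<omega>: "\<omega> \<in> space M" and \<mu>: "0 \<le> \<mu>" and t: "0 < t"
  shows "1 = ennreal (exp (- \<mu> * sojourn_time (drifted \<rho>) t \<omega>)) +
    (\<integral>\<^sup>+s. ennreal (indicator {0<..<t} s * (\<mu> * indicator {0..} (drifted \<rho> s \<omega>) * exp (- \<mu> * sojourn_time (drifted \<rho>) s \<omega>))) \<partial>lborel)"
proof -
  let ?A = "\<lambda>t. sojourn_time (drifted \<rho>) t \<omega>"
  let ?h = "\<lambda>s. indicator {0..} (drifted \<rho> s \<omega>) :: real"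
  have [measurable]: "(\<lambda>s. drifted \<rho> s \<omega>) \<in> borel_measurable borel"
    using continuous_drifted[OF \<omega>] by (rule borel_measurable_continuous_onI)
  have hA: "(\<lambda>s. ?h s * exp (- \<mu> * ?A s)) \<in> borel_measurable borel"
    using \<omega> by measurable
  have id: "exp (- \<mu> * ?A t) + \<mu> * (LBINT s:{0..t}. ?h s * exp (- \<mu> * ?A s)) = 1"
    using exp_primitive_identity[of ?h \<mu> t] \<mu> t by (simp add: sojourn_time_def)
  have int: "set_integrable lborel {0..t} (\<lambda>s. ?h s * exp (- \<mu> * ?A s))"
    unfolding set_integrable_def
    by (rule integrableI_bounded_set_indicator[where B=1])
       (use hA \<mu> in \<open>auto simp: emeasure_lborel_Icc_eq sojourn_nonneg intro!: AE_I2 split: split_indicator\<close>)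
  have "(\<integral>\<^sup>+s. ennreal (indicator {0<..<t} s * (\<mu> * ?h s * exp (- \<mu> * ?A s))) \<partial>lborel) = (\<integral>\<^sup>+s. ennreal (\<mu> * (indicator {0..t} s *\<^sub>R (?h s * exp (- \<mu> * ?A s)))) \<partial>lborel)"
    using AE_lborel_singleton[of 0] AE_lborel_singleton[of t]
    by (intro nn_integral_cong_AE, eventually_elim) (auto split: split_indicator)
  also have "\<dots> = ennreal (\<mu> * (LBINT s:{0..t}. ?h s * exp (- \<mu> * ?A s)))"
    unfolding set_lebesgue_integral_def integral_mult_right_zero[symmetric]
    using int \<mu> by (intro nn_integral_eq_integral) (auto simp: set_integrable_def)
  finally have "ennreal (exp (- \<mu> * ?A t)) + (\<integral>\<^sup>+s. ennreal (indicator {0<..<t} s * (\<mu> * ?h s * exp (- \<mu> * ?A s))) \<partial>lborel)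
     = ennreal (exp (- \<mu> * ?A t) + \<mu> * (LBINT s:{0..t}. ?h s * exp (- \<mu> * ?A s)))"
    using \<mu> by (subst ennreal_plus) (auto simp: set_lebesgue_integral_def intro!: mult_nonneg_nonneg integral_nonneg_AE)
  then show ?thesis using id by simp
qed

text \<open>For \<open>\<nu>(g) = E \<integral> exp (- \<kappa> t - \<mu> A\<^sub>t) g(X\<^sub>t) dt\<close> the forward Kac equation reads
  \<open>\<nu>(g) + \<mu> \<nu>(1[x \<ge> 0] U g) = U g (0)\<close> with \<open>U\<close> the resolvent of the free process. It is applied to an
  \<open>f\<close> with \<open>f + \<mu> 1[x \<ge> 0] U f = 1\<close>.\<close>

lemma laplace_exp_sojourn:
  fixes \<rho> \<kappa> \<mu> :: real
  assumes \<mu>: "0 < \<mu>" "\<mu> \<le> \<kappa>"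
  shows "(\<integral>\<^sup>+t. ennreal (indicator {0<..} t * exp (- \<kappa> * t)) * (\<integral>\<^sup>+\<omega>. ennreal (exp (- \<mu> * sojourn_time (drifted \<rho>) t \<omega>)) \<partial>M) \<partial>lborel)
    = ennreal (2 / ((sqrt (2 * (\<kappa> + \<mu>) + \<rho>\<^sup>2) - \<rho>) * (sqrt (2 * \<kappa> + \<rho>\<^sup>2) + \<rho>)))"
proof -
  interpret MP: pair_sigma_finite M lborel ..
  have \<kappa>: "0 < \<kappa>" using \<mu> by simp
  define \<gamma> where "\<gamma> = sqrt (2 * \<kappa> + \<rho>\<^sup>2)"
  define \<delta> where "\<delta> = sqrt (2 * (\<kappa> + \<mu>) + \<rho>\<^sup>2)"
  define u where "u x = 1 / (\<kappa> + \<mu>) + (\<delta> - \<gamma>) / ((\<kappa> + \<mu>) * (\<rho> + \<gamma>)) * exp (- (\<rho> + \<delta>) * x)" for x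
  define f where "f y = ennreal (if y < 0 then 1 else 1 - \<mu> * u y)" for y
  define k where "k t = ennreal (indicator {0<..} t * exp (- \<kappa> * t))" for t
  define U where "U x = (\<integral>\<^sup>+r. k r * drift_semigroup \<rho> f r x \<partial>lborel)" for x
  let ?I = "\<lambda>t s. if 0 < s \<and> s < t then 1 else (0 :: ennreal)"
  let ?e = "\<lambda>t \<omega>. ennreal (exp (- \<mu> * sojourn_time (drifted \<rho>) t \<omega>))"
  let ?G = "\<lambda>s \<omega>. ennreal (\<mu> * indicator {0..} (drifted \<rho> s \<omega>) * exp (- \<mu> * sojourn_time (drifted \<rho>) s \<omega>))"
  have f_meas[measurable]: "f \<in> borel_measurable borel" unfolding f_def u_def by measurable
  have [measurable]: "k \<in> borel_measurable borel" unfolding k_def by measurable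
  have [measurable]: "U \<in> borel_measurable borel" unfolding U_def by measurable
  \<comment> \<open>The closed form of \<open>U\<close> on the half-line suffices: on the negative
    side the Kac equation multiplies \<open>U\<close> by 0, and the final evaluation is at
    0.\<close>
  have U: "U x = ennreal (u x)" and u_nonneg: "0 \<le> u x" and f_nonneg: "0 \<le> 1 - \<mu> * u x" if "0 \<le> x" for x
  proof -
    show "U x = ennreal (u x)"
      unfolding U_def k_def resolvent_drift_semigroup[OF \<kappa> f_meas] f_def u_def \<gamma>_def \<delta>_def
      by (rule resolvent_exponential(4)[OF \<mu> that])
    show "0 \<le> u x"
      unfolding u_def \<gamma>_def \<delta>_def by (rule resolvent_exponential(2)[OF \<mu> that])
    show "0 \<le> 1 - \<mu> * u x"
      using resolvent_exponential(1)[OF \<mu> that, where \<rho>=\<rho> and y=x] that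
      unfolding u_def \<gamma>_def \<delta>_def by (simp add: not_less)
  qed
  have f_U: "f x + ennreal (\<mu> * indicator {0..} x) * U x = 1" for x
    using \<mu> U[of x] u_nonneg[of x] f_nonneg[of x]
    by (cases "0 \<le> x") (simp_all add: f_def ennreal_mult[symmetric] ennreal_plus[symmetric] del: ennreal_plus)
  have step: "drift_semigroup \<rho> f t 0 = (\<integral>\<^sup>+\<omega>. ?e t \<omega> * f (drifted \<rho> t \<omega>) \<partial>M) +
      (\<integral>\<^sup>+s. ?I t s * (\<integral>\<^sup>+\<omega>. ?G s \<omega> * drift_semigroup \<rho> f (t - s) (drifted \<rho> s \<omega>) \<partial>M) \<partial>lborel)" if t: "0 < t" for t
  proof -
    have "drift_semigroup \<rho> f t 0 = (\<integral>\<^sup>+\<omega>. f (drifted \<rho> t \<omega>) \<partial>M)"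
      using nn_integral_drifted_markov[of 0 t "\<lambda>_. 1" f \<rho>] t by (simp add: emeasure_space_1)
    also have "\<dots> = (\<integral>\<^sup>+\<omega>. ?e t \<omega> * f (drifted \<rho> t \<omega>) + (\<integral>\<^sup>+s. ?I t s * (?G s \<omega> * f (drifted \<rho> t \<omega>)) \<partial>lborel) \<partial>M)"
    proof (rule nn_integral_cong)
      fix \<omega> assume \<omega>[measurable]: "\<omega> \<in> space M"
      have "1 = ?e t \<omega> + (\<integral>\<^sup>+s. ?I t s * ?G s \<omega> \<partial>lborel)"
        using \<mu> t
        by (subst exp_sojourn_identity[OF \<omega>, of \<mu> t \<rho>])
           (auto intro!: arg_cong2[where f="(+)"] nn_integral_cong split: split_indicator)
      then have "f (drifted \<rho> t \<omega>) = (?e t \<omega> + (\<integral>\<^sup>+s. ?I t s * ?G s \<omega> \<partial>lborel)) * f (drifted \<rho> t \<omega>)" by simp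
      also have "\<dots> = ?e t \<omega> * f (drifted \<rho> t \<omega>) + (\<integral>\<^sup>+s. ?I t s * (?G s \<omega> * f (drifted \<rho> t \<omega>)) \<partial>lborel)"
        unfolding distrib_right
        by (subst nn_integral_multc[symmetric], (measurable)[1]) (simp only: mult.assoc)
      finally show "f (drifted \<rho> t \<omega>) = ?e t \<omega> * f (drifted \<rho> t \<omega>) + (\<integral>\<^sup>+s. ?I t s * (?G s \<omega> * f (drifted \<rho> t \<omega>)) \<partial>lborel)" .
    qed
    also have "\<dots> = (\<integral>\<^sup>+\<omega>. ?e t \<omega> * f (drifted \<rho> t \<omega>) \<partial>M) + (\<integral>\<^sup>+\<omega>. \<integral>\<^sup>+s. ?I t s * (?G s \<omega> * f (drifted \<rho> t \<omega>)) \<partial>lborel \<partial>M)"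
      by (rule nn_integral_add) measurable
    also have "(\<integral>\<^sup>+\<omega>. \<integral>\<^sup>+s. ?I t s * (?G s \<omega> * f (drifted \<rho> t \<omega>)) \<partial>lborel \<partial>M) = (\<integral>\<^sup>+s. \<integral>\<^sup>+\<omega>. ?I t s * (?G s \<omega> * f (drifted \<rho> t \<omega>)) \<partial>M \<partial>lborel)"
      by (rule MP.Fubini'[symmetric]) measurable
    \<comment> \<open>The weight at time \<open>s\<close> belongs to the past of \<open>s\<close>,
      so the Markov property replaces \<open>f\<close> at time \<open>t\<close> by the semigroup at
      the position at time \<open>s\<close>.\<close>
    also have "\<dots> = (\<integral>\<^sup>+s. ?I t s * (\<integral>\<^sup>+\<omega>. ?G s \<omega> * drift_semigroup \<rho> f (t - s) (drifted \<rho> s \<omega>) \<partial>M) \<partial>lborel)"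
    proof (rule nn_integral_cong)
      fix s :: real
      show "(\<integral>\<^sup>+\<omega>. ?I t s * (?G s \<omega> * f (drifted \<rho> t \<omega>)) \<partial>M) = ?I t s * (\<integral>\<^sup>+\<omega>. ?G s \<omega> * drift_semigroup \<rho> f (t - s) (drifted \<rho> s \<omega>) \<partial>M)"
      proof (cases "s \<in> {0<..<t}")
        case True
        have [measurable]: "sojourn_time (drifted \<rho>) s \<in> borel_measurable (past s)" "drifted \<rho> s \<in> borel_measurable (past s)"
          using True by (auto intro: measurable_sojourn_past measurable_drifted_past)
        have "?G s \<in> borel_measurable (past s)" by measurable
        then show ?thesis using True nn_integral_drifted_markov[of s t "?G s" f \<rho>] by simp
      qed auto
    qed
    finally show ?thesis .
  qed
  \<comment> \<open>With \<open>t = s + r\<close> the exponential weight splits as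
    \<open>k s * k r\<close>, and the integral over \<open>r\<close> is the resolvent. The exchanges
    below bring the integral over \<open>t\<close> innermost so that this applies at the position at
    time \<open>s\<close>.\<close>
  have shift: "(\<integral>\<^sup>+t. k t * ?I t s * drift_semigroup \<rho> f (t - s) x \<partial>lborel) = k s * U x" for s x
  proof -
    have "(\<integral>\<^sup>+t. k t * ?I t s * drift_semigroup \<rho> f (t - s) x \<partial>lborel) =
      (\<integral>\<^sup>+r. k (s + 1 * r) * ?I (s + 1 * r) s * drift_semigroup \<rho> f (s + 1 * r - s) x \<partial>lborel)"
      by (subst nn_integral_real_affine[where c=1 and t=s]) simp_all
    also have "\<dots> = (\<integral>\<^sup>+r. k s * (k r * drift_semigroup \<rho> f r x) \<partial>lborel)"
      by (intro nn_integral_cong)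
         (auto simp: k_def exp_add[symmetric] algebra_simps ennreal_mult[symmetric] split: split_indicator)
    also have "\<dots> = k s * U x" unfolding U_def by (rule nn_integral_cmult) measurable
    finally show ?thesis .
  qed
  have "U 0 = (\<integral>\<^sup>+t. k t * (\<integral>\<^sup>+\<omega>. ?e t \<omega> * f (drifted \<rho> t \<omega>) \<partial>M) +
      k t * (\<integral>\<^sup>+s. ?I t s * (\<integral>\<^sup>+\<omega>. ?G s \<omega> * drift_semigroup \<rho> f (t - s) (drifted \<rho> s \<omega>) \<partial>M) \<partial>lborel) \<partial>lborel)"
    unfolding U_def
  proof (rule nn_integral_cong)
    fix t :: real
    show "k t * drift_semigroup \<rho> f t 0 = k t * (\<integral>\<^sup>+\<omega>. ?e t \<omega> * f (drifted \<rho> t \<omega>) \<partial>M) +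
      k t * (\<integral>\<^sup>+s. ?I t s * (\<integral>\<^sup>+\<omega>. ?G s \<omega> * drift_semigroup \<rho> f (t - s) (drifted \<rho> s \<omega>) \<partial>M) \<partial>lborel)"
      by (cases "0 < t") (simp_all add: step distrib_left, simp add: k_def)
  qed
  also have "\<dots> = (\<integral>\<^sup>+t. k t * (\<integral>\<^sup>+\<omega>. ?e t \<omega> * f (drifted \<rho> t \<omega>) \<partial>M) \<partial>lborel) +
      (\<integral>\<^sup>+t. k t * (\<integral>\<^sup>+s. ?I t s * (\<integral>\<^sup>+\<omega>. ?G s \<omega> * drift_semigroup \<rho> f (t - s) (drifted \<rho> s \<omega>) \<partial>M) \<partial>lborel) \<partial>lborel)"
    by (rule nn_integral_add) measurable
  also have "(\<integral>\<^sup>+t. k t * (\<integral>\<^sup>+s. ?I t s * (\<integral>\<^sup>+\<omega>. ?G s \<omega> * drift_semigroup \<rho> f (t - s) (drifted \<rho> s \<omega>) \<partial>M) \<partial>lborel) \<partial>lborel)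
      = (\<integral>\<^sup>+t. \<integral>\<^sup>+s. \<integral>\<^sup>+\<omega>. k t * ?I t s * drift_semigroup \<rho> f (t - s) (drifted \<rho> s \<omega>) * ?G s \<omega> \<partial>M \<partial>lborel \<partial>lborel)"
    by (subst nn_integral_cmult[symmetric], (measurable)[1])+ (simp add: ac_simps)
  also have "\<dots> = (\<integral>\<^sup>+s. \<integral>\<^sup>+t. \<integral>\<^sup>+\<omega>. k t * ?I t s * drift_semigroup \<rho> f (t - s) (drifted \<rho> s \<omega>) * ?G s \<omega> \<partial>M \<partial>lborel \<partial>lborel)"
    by (rule lborel_pair.Fubini'[symmetric]) measurable
  also have "\<dots> = (\<integral>\<^sup>+s. \<integral>\<^sup>+\<omega>. \<integral>\<^sup>+t. k t * ?I t s * drift_semigroup \<rho> f (t - s) (drifted \<rho> s \<omega>) * ?G s \<omega> \<partial>lborel \<partial>M \<partial>lborel)"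
    by (intro nn_integral_cong MP.Fubini') measurable
  also have "\<dots> = (\<integral>\<^sup>+s. \<integral>\<^sup>+\<omega>. k s * U (drifted \<rho> s \<omega>) * ?G s \<omega> \<partial>M \<partial>lborel)"
    by (intro nn_integral_cong, subst nn_integral_multc) (measurable, simp only: shift)
  also have "\<dots> = (\<integral>\<^sup>+s. k s * (\<integral>\<^sup>+\<omega>. ?e s \<omega> * (ennreal (\<mu> * indicator {0..} (drifted \<rho> s \<omega>)) * U (drifted \<rho> s \<omega>)) \<partial>M) \<partial>lborel)"
  proof (rule nn_integral_cong)
    fix s :: real
    have "?G s \<omega> = ?e s \<omega> * ennreal (\<mu> * indicator {0..} (drifted \<rho> s \<omega>))" for \<omega>
      using \<mu> by (simp add: ennreal_mult[symmetric] mult.commute)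
    then show "(\<integral>\<^sup>+\<omega>. k s * U (drifted \<rho> s \<omega>) * ?G s \<omega> \<partial>M) = k s * (\<integral>\<^sup>+\<omega>. ?e s \<omega> * (ennreal (\<mu> * indicator {0..} (drifted \<rho> s \<omega>)) * U (drifted \<rho> s \<omega>)) \<partial>M)"
      by (subst nn_integral_cmult[symmetric]) (measurable, simp add: ac_simps)
  qed
  also have "(\<integral>\<^sup>+t. k t * (\<integral>\<^sup>+\<omega>. ?e t \<omega> * f (drifted \<rho> t \<omega>) \<partial>M) \<partial>lborel) + \<dots> =
      (\<integral>\<^sup>+t. k t * (\<integral>\<^sup>+\<omega>. ?e t \<omega> * f (drifted \<rho> t \<omega>) \<partial>M) + k t * (\<integral>\<^sup>+\<omega>. ?e t \<omega> * (ennreal (\<mu> * indicator {0..} (drifted \<rho> t \<omega>)) * U (drifted \<rho> t \<omega>)) \<partial>M) \<partial>lborel)"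
    by (rule nn_integral_add[symmetric]) measurable
  also have "\<dots> = (\<integral>\<^sup>+t. k t * (\<integral>\<^sup>+\<omega>. ?e t \<omega> \<partial>M) \<partial>lborel)"
  proof (rule nn_integral_cong)
    fix t :: real
    have "(\<integral>\<^sup>+\<omega>. ?e t \<omega> * f (drifted \<rho> t \<omega>) \<partial>M) + (\<integral>\<^sup>+\<omega>. ?e t \<omega> * (ennreal (\<mu> * indicator {0..} (drifted \<rho> t \<omega>)) * U (drifted \<rho> t \<omega>)) \<partial>M) =
      (\<integral>\<^sup>+\<omega>. ?e t \<omega> * f (drifted \<rho> t \<omega>) + ?e t \<omega> * (ennreal (\<mu> * indicator {0..} (drifted \<rho> t \<omega>)) * U (drifted \<rho> t \<omega>)) \<partial>M)"
      by (rule nn_integral_add[symmetric]) measurable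
    also have "\<dots> = (\<integral>\<^sup>+\<omega>. ?e t \<omega> \<partial>M)" by (simp add: distrib_left[symmetric] f_U)
    finally show "k t * (\<integral>\<^sup>+\<omega>. ?e t \<omega> * f (drifted \<rho> t \<omega>) \<partial>M) + k t * (\<integral>\<^sup>+\<omega>. ?e t \<omega> * (ennreal (\<mu> * indicator {0..} (drifted \<rho> t \<omega>)) * U (drifted \<rho> t \<omega>)) \<partial>M) = k t * (\<integral>\<^sup>+\<omega>. ?e t \<omega> \<partial>M)"
      by (simp add: distrib_left[symmetric])
  qed
  finally have "(\<integral>\<^sup>+t. k t * (\<integral>\<^sup>+\<omega>. ?e t \<omega> \<partial>M) \<partial>lborel) = U 0" ..
  also have "U 0 = ennreal (u 0)" by (rule U) simp
  also have "u 0 = 2 / ((\<delta> - \<rho>) * (\<gamma> + \<rho>))"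
    using resolvent_exponential(3)[OF \<mu>, of 0 \<rho>] by (simp add: u_def \<gamma>_def \<delta>_def)
  finally show ?thesis unfolding k_def \<gamma>_def \<delta>_def .
qed

end

section \<open>The law of the sojourn time\<close>

lemma nn_integral_exp_greaterThan:
  fixes \<kappa> :: real
  assumes "0 < \<kappa>"
  shows "(\<integral>\<^sup>+t. ennreal (indicator {0<..} t * exp (- \<kappa> * t)) \<partial>lborel) = ennreal (1 / \<kappa>)"
proof -
  let ?F = "\<lambda>t. - exp (- \<kappa> * t) / \<kappa>"
  have "(\<integral>\<^sup>+t. ennreal (indicator {0<..} t * exp (- \<kappa> * t)) \<partial>lborel) = ennreal (0 - ?F 0)"
  proof (rule nn_integral_FTC_greaterThan)
    show "(?F has_real_derivative exp (- \<kappa> * t)) (at t)" for t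
      using assms by (auto intro!: derivative_eq_intros)
    show "(?F \<longlongrightarrow> 0) at_top" using assms by real_asymp
    have "isCont ?F 0" using assms by (intro continuous_intros) auto
    then show "(?F \<longlongrightarrow> ?F 0) (at_right 0)" by (simp add: isCont_def filterlim_at_split)
  qed (auto intro!: continuous_intros)
  then show ?thesis by simp
qed

section \<open>Inversion of the double transform\<close>

context brownian_motion
begin

text \<open>On nonnegative times each path of the sojourn time is Lipschitz with constant 1, and the
  exponentials are bounded by 1, so dominated convergence applies.\<close>

lemma isCont_laplace_sojourn:
  assumes \<mu>: "0 \<le> \<mu>" and t: "0 < t"
  shows "isCont (\<lambda>t. expectation (\<lambda>\<omega>. exp (- \<mu> * sojourn_time (drifted \<rho>) t \<omega>))) t"
proof -
  have lip: "\<bar>sojourn_time (drifted \<rho>) b \<omega> - sojourn_time (drifted \<rho>) a \<omega>\<bar> \<le> b - a" if ab: "a \<le> b" "0 \<le> a" and \<omega>: "\<omega> \<in> space M" for a b \<omega>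
  proof -
    let ?h = "\<lambda>s. indicator {0..} (drifted \<rho> s \<omega>) :: real"
    have [measurable]: "(\<lambda>s. drifted \<rho> s \<omega>) \<in> borel_measurable borel"
      using continuous_drifted[OF \<omega>] by (rule borel_measurable_continuous_onI)
    have int: "integrable lborel (\<lambda>s. indicator {0..c} s *\<^sub>R ?h s)" for c
      by (rule integrableI_bounded_set_indicator[where B=1]) (auto simp: emeasure_lborel_Icc_eq intro!: AE_I2)
    have "\<bar>sojourn_time (drifted \<rho>) b \<omega> - sojourn_time (drifted \<rho>) a \<omega>\<bar> = \<bar>\<integral>s. indicator {0..b} s *\<^sub>R ?h s - indicator {0..a} s *\<^sub>R ?h s \<partial>lborel\<bar>"
      unfolding sojourn_time_def set_lebesgue_integral_def
      by (subst Bochner_Integration.integral_diff) (simp_all only: int)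
    also have "\<dots> \<le> (\<integral>s. indicator {a..b} s \<partial>lborel)"
      unfolding real_norm_def[symmetric]
    proof (rule Bochner_Integration.integral_norm_bound_integral)
      show "integrable lborel (\<lambda>s. indicator {0..b} s *\<^sub>R ?h s - indicator {0..a} s *\<^sub>R ?h s)"
        by (intro Bochner_Integration.integrable_diff int)
      show "integrable lborel (indicator {a..b} :: real \<Rightarrow> real)"
        by (rule integrable_real_indicator) (simp_all add: emeasure_lborel_Icc_eq)
      show "norm (indicator {0..b} s *\<^sub>R ?h s - indicator {0..a} s *\<^sub>R ?h s) \<le> indicator {a..b} s" for s
        using ab by (auto split: split_indicator)
    qed
    also have "\<dots> = b - a" using ab by simp
    finally show ?thesis .
  qed
  have lip': "\<bar>sojourn_time (drifted \<rho>) b \<omega> - sojourn_time (drifted \<rho>) a \<omega>\<bar> \<le> \<bar>b - a\<bar>" if "0 \<le> a" "0 \<le> b" "\<omega> \<in> space M" for a b \<omega>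
    using lip[of a b \<omega>] lip[of b a \<omega>] that by (cases "a \<le> b") auto
  have "(\<lambda>n. expectation (\<lambda>\<omega>. exp (- \<mu> * sojourn_time (drifted \<rho>) (S n) \<omega>))) \<longlonglongrightarrow> expectation (\<lambda>\<omega>. exp (- \<mu> * sojourn_time (drifted \<rho>) t \<omega>))"
    if S: "S \<longlonglongrightarrow> t" for S :: "nat \<Rightarrow> real"
  proof (rule integral_dominated_convergence[where w="\<lambda>_. 1"])
    show "AE \<omega> in M. (\<lambda>n. exp (- \<mu> * sojourn_time (drifted \<rho>) (S n) \<omega>)) \<longlonglongrightarrow> exp (- \<mu> * sojourn_time (drifted \<rho>) t \<omega>)"
    proof (rule AE_I2)
      fix \<omega> assume \<omega>: "\<omega> \<in> space M"
      have "(\<lambda>n. sojourn_time (drifted \<rho>) (S n) \<omega> - sojourn_time (drifted \<rho>) t \<omega>) \<longlonglongrightarrow> 0"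
      proof (rule Lim_null_comparison)
        have "\<forall>\<^sub>F n in sequentially. 0 < S n" using order_tendstoD(1)[OF S t] .
        then show "\<forall>\<^sub>F n in sequentially. norm (sojourn_time (drifted \<rho>) (S n) \<omega> - sojourn_time (drifted \<rho>) t \<omega>) \<le> \<bar>S n - t\<bar>"
          by eventually_elim (use lip' t \<omega> in auto)
        show "(\<lambda>n. \<bar>S n - t\<bar>) \<longlonglongrightarrow> 0" using S by (simp add: LIM_zero tendsto_rabs_zero)
      qed
      then have "(\<lambda>n. sojourn_time (drifted \<rho>) (S n) \<omega>) \<longlonglongrightarrow> sojourn_time (drifted \<rho>) t \<omega>" by (rule LIM_zero_cancel)
      then show "(\<lambda>n. exp (- \<mu> * sojourn_time (drifted \<rho>) (S n) \<omega>)) \<longlonglongrightarrow> exp (- \<mu> * sojourn_time (drifted \<rho>) t \<omega>)"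
        by (intro tendsto_intros)
    qed
  qed (use \<mu> in \<open>auto simp: sojourn_nonneg\<close>)
  then show ?thesis by (auto simp: continuous_at_sequentially comp_def)
qed

text \<open>Keeping the two factors abstract lets both signs of \<rho> share one inversion. For
  fixed \<mu> = \<open>n\<close>, uniqueness in the time variable gives the transform of the law for
  almost every \<open>t\<close>, and continuity gives it for every \<open>t\<close>; uniqueness in
  \<mu> then identifies the law.\<close>

lemma distr_sojourn:
  fixes L R :: "real \<Rightarrow> real" and \<rho> t :: real
  assumes meas[measurable]: "L \<in> borel_measurable borel" "R \<in> borel_measurable borel"
    and nonneg: "\<And>s. 0 \<le> L s" "\<And>s. 0 \<le> R s"
    and anti: "\<And>s t. 0 < s \<Longrightarrow> s \<le> t \<Longrightarrow> L t \<le> L s" "\<And>s t. 0 < s \<Longrightarrow> s \<le> t \<Longrightarrow> R t \<le> R s"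
    and cont: "\<And>s. 0 < s \<Longrightarrow> isCont L s" "\<And>s. 0 < s \<Longrightarrow> isCont R s"
    and laplace: "\<And>\<kappa> \<mu>. 0 < \<kappa> \<Longrightarrow> 0 \<le> \<mu> \<Longrightarrow> (\<integral>\<^sup>+s. ennreal (indicator {0<..} s * (exp (- (\<kappa> + \<mu>) * s) * L s)) \<partial>lborel) * (\<integral>\<^sup>+s. ennreal (indicator {0<..} s * (exp (- \<kappa> * s) * R s)) \<partial>lborel)
      = ennreal (2 / ((sqrt (2 * (\<kappa> + \<mu>) + \<rho>\<^sup>2) - \<rho>) * (sqrt (2 * \<kappa> + \<rho>\<^sup>2) + \<rho>)))"
    and t: "0 < t"
  shows "distr M borel (sojourn_time (drifted \<rho>) t) = density lborel (\<lambda>s. if 0 < s \<and> s < t then ennreal (L s * R (t - s)) else 0)"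
proof -
  let ?A = "sojourn_time (drifted \<rho>)"
  define H where "H \<mu> t = (\<integral>\<^sup>+s. ennreal (indicator {0<..<t} s * (exp (- \<mu> * s) * (L s * R (t - s)))) \<partial>lborel)" for \<mu> t
  define F where "F \<mu> t = expectation (\<lambda>\<omega>. exp (- \<mu> * ?A t \<omega>))" for \<mu> t
  have F: "ennreal (F \<mu> t) = (\<integral>\<^sup>+\<omega>. ennreal (exp (- \<mu> * ?A t \<omega>)) \<partial>M)" if "0 \<le> \<mu>" for \<mu> t
    unfolding F_def using that
    by (intro nn_integral_eq_integral[symmetric] integrable_const_bound[of _ 1]) (auto simp: sojourn_nonneg)
  have [measurable]: "F \<mu> \<in> borel_measurable borel" for \<mu>
    unfolding F_def by measurable
  have H': "H \<mu> t = (\<integral>\<^sup>+s. (if 0 < s \<and> s < t then ennreal (exp (- \<mu> * s) * (L s * R (t - s))) else 0) \<partial>lborel)" for \<mu> t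
    unfolding H_def by (intro nn_integral_cong) (auto split: split_indicator)
  have [measurable]: "H \<mu> \<in> borel_measurable borel" for \<mu>
    unfolding H' by measurable
  have lapF: "(\<integral>\<^sup>+t. ennreal (indicator {0<..} t * exp (- \<kappa> * t)) * ennreal (F \<mu> t) \<partial>lborel)
    = ennreal (2 / ((sqrt (2 * (\<kappa> + \<mu>) + \<rho>\<^sup>2) - \<rho>) * (sqrt (2 * \<kappa> + \<rho>\<^sup>2) + \<rho>)))" if "0 \<le> \<mu>" "\<mu> \<le> \<kappa>" "0 < \<kappa>" for \<kappa> \<mu>
  proof (cases "\<mu> = 0")
    case True
    have "(sqrt (2 * \<kappa> + \<rho>\<^sup>2) - \<rho>) * (sqrt (2 * \<kappa> + \<rho>\<^sup>2) + \<rho>) = (sqrt (2 * \<kappa> + \<rho>\<^sup>2))\<^sup>2 - \<rho>\<^sup>2"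
      by (simp add: power2_eq_square algebra_simps)
    also have "\<dots> = 2 * \<kappa>" using that by simp
    finally show ?thesis
      using True nn_integral_exp_greaterThan[OF that(3)] prob_space by (simp add: F_def)
  qed (use that laplace_exp_sojourn[of \<mu> \<kappa> \<rho>] in \<open>simp add: F\<close>)
  have lapH: "(\<integral>\<^sup>+t. ennreal (indicator {0<..} t * exp (- \<kappa> * t)) * H \<mu> t \<partial>lborel)
    = ennreal (2 / ((sqrt (2 * (\<kappa> + \<mu>) + \<rho>\<^sup>2) - \<rho>) * (sqrt (2 * \<kappa> + \<rho>\<^sup>2) + \<rho>)))" if "0 \<le> \<mu>" "0 < \<kappa>" for \<kappa> \<mu>
    unfolding H_def laplace_convolution[OF meas nonneg] by (rule laplace[OF that(2,1)])
  have HF: "H (real n) t = ennreal (F (real n) t)" if t: "0 < t" for n t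
  proof -
    \<comment> \<open>The weight has exponent \<open>n + 1\<close>, so that its transform at
      \<open>m\<close> is the one at \<open>\<kappa> = n + 1 + m\<close>. This keeps \<kappa>
      positive and at least \<open>n\<close>, and makes the weighted measure finite.\<close>
    define k where "k t = ennreal (indicator {0<..} t * exp (- (real n + 1) * t))" for t
    have [measurable]: "k \<in> borel_measurable borel" unfolding k_def by measurable
    have shift: "ennreal (exp (- real m * t)) * k t = ennreal (indicator {0<..} t * exp (- (real n + 1 + real m) * t))" for m t
      unfolding k_def by (auto simp: ennreal_mult[symmetric] exp_add[symmetric] algebra_simps split: split_indicator)
    have lap_density: "(\<integral>\<^sup>+t. ennreal (exp (- real m * t)) \<partial>density lborel (\<lambda>t. k t * g t))
        = (\<integral>\<^sup>+t. ennreal (indicator {0<..} t * exp (- (real n + 1 + real m) * t)) * g t \<partial>lborel)"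
      if [measurable]: "g \<in> borel_measurable borel" for g m
    proof -
      have "(\<integral>\<^sup>+t. ennreal (exp (- real m * t)) \<partial>density lborel (\<lambda>t. k t * g t)) = (\<integral>\<^sup>+t. k t * g t * ennreal (exp (- real m * t)) \<partial>lborel)"
        by (rule nn_integral_density) measurable
      also have "\<dots> = (\<integral>\<^sup>+t. (ennreal (exp (- real m * t)) * k t) * g t \<partial>lborel)"
        by (simp only: ac_simps)
      finally show ?thesis unfolding shift .
    qed
    let ?c = "\<lambda>m. 2 / ((sqrt (2 * (real n + 1 + real m + real n) + \<rho>\<^sup>2) - \<rho>) * (sqrt (2 * (real n + 1 + real m) + \<rho>\<^sup>2) + \<rho>))"
    have densF: "(\<integral>\<^sup>+t. ennreal (exp (- real m * t)) \<partial>density lborel (\<lambda>t. k t * ennreal (F (real n) t))) = ennreal (?c m)" for m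
      by (subst lap_density, measurable) (rule lapF, simp_all)
    have densH: "(\<integral>\<^sup>+t. ennreal (exp (- real m * t)) \<partial>density lborel (\<lambda>t. k t * H (real n) t)) = ennreal (?c m)" for m
      by (subst lap_density, measurable) (rule lapH, simp_all)
    have "density lborel (\<lambda>t. k t * ennreal (F (real n) t)) = density lborel (\<lambda>t. k t * H (real n) t)"
    proof (rule measure_eqI_laplace)
      fix m :: nat
      show "(\<integral>\<^sup>+t. ennreal (exp (- real m * t)) \<partial>density lborel (\<lambda>t. k t * ennreal (F (real n) t))) =
        (\<integral>\<^sup>+t. ennreal (exp (- real m * t)) \<partial>density lborel (\<lambda>t. k t * H (real n) t))"
        unfolding densF densH ..
    next
      have "emeasure (density lborel (\<lambda>t. k t * ennreal (F (real n) t))) UNIV = (\<integral>\<^sup>+t. ennreal (exp (- real 0 * t)) \<partial>density lborel (\<lambda>t. k t * ennreal (F (real n) t)))"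
        by simp
      then show "emeasure (density lborel (\<lambda>t. k t * ennreal (F (real n) t))) UNIV \<noteq> \<infinity>" unfolding densF by simp
    qed (auto simp: AE_density k_def split: split_indicator)
    then have "AE t in lborel. k t * ennreal (F (real n) t) = k t * H (real n) t"
      by (subst (asm) sigma_finite_measure.density_unique_iff[OF sigma_finite_lborel]) simp_all
    then have "AE t in lborel. 0 < t \<longrightarrow> H (real n) t = ennreal (F (real n) t)"
      by eventually_elim (auto simp: k_def ennreal_mult_cancel_left)
    then show ?thesis
      unfolding H_def F_def
      by (intro convolution_eq_everywhere[OF meas nonneg anti cont] isCont_laplace_sojourn t of_nat_0_le_iff)
  qed
  show ?thesis
  proof (rule measure_eqI_laplace)
    have "emeasure (distr M borel (?A t)) UNIV = 1" by (subst emeasure_distr) (simp_all add: emeasure_space_1)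
    then show "emeasure (distr M borel (?A t)) UNIV \<noteq> \<infinity>" by simp
    show "AE x in distr M borel (?A t). 0 \<le> x" by (subst AE_distr_iff) (simp_all add: sojourn_nonneg)
    show "AE x in density lborel (\<lambda>s. if 0 < s \<and> s < t then ennreal (L s * R (t - s)) else 0). 0 \<le> x"
      by (subst AE_density) auto
    fix n :: nat
    have "(\<integral>\<^sup>+x. ennreal (exp (- real n * x)) \<partial>distr M borel (?A t)) = ennreal (F (real n) t)"
      unfolding F[OF of_nat_0_le_iff] by (subst nn_integral_distr) simp_all
    also have "\<dots> = H (real n) t" by (rule HF[OF t, symmetric])
    also have "\<dots> = (\<integral>\<^sup>+x. ennreal (exp (- real n * x)) \<partial>density lborel (\<lambda>s. if 0 < s \<and> s < t then ennreal (L s * R (t - s)) else 0))"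
      unfolding H' using nonneg
      by (subst nn_integral_density) (auto intro!: nn_integral_cong simp: ennreal_mult[symmetric] mult.commute)
    finally show "(\<integral>\<^sup>+x. ennreal (exp (- real n * x)) \<partial>distr M borel (?A t)) =
      (\<integral>\<^sup>+x. ennreal (exp (- real n * x)) \<partial>density lborel (\<lambda>s. if 0 < s \<and> s < t then ennreal (L s * R (t - s)) else 0))" .
  qed simp_all
qed

text \<open>The process \<open>with_drift B \<rho>\<close> starts at 0 only almost surely, so its
  sojourn time agrees with that of \<open>drifted \<rho>\<close> almost everywhere. As
  \<open>M\<close> need not be complete, measurability does not transfer along this and is shown
  directly, by writing the motion as \<open>drifted \<rho>\<close> plus \<open>B 0\<close>.\<close>

lemma distributed_sojourn_with_drift:
  fixes L R :: "real \<Rightarrow> real" and \<rho> t :: real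
  assumes meas[measurable]: "L \<in> borel_measurable borel" "R \<in> borel_measurable borel"
    and distr: "distr M borel (sojourn_time (drifted \<rho>) t) = density lborel (\<lambda>s. if 0 < s \<and> s < t then ennreal (L s * R (t - s)) else 0)"
  shows "distributed M lborel (sojourn_time (with_drift B \<rho>) t) (\<lambda>s. if 0 < s \<and> s < t then ennreal (L s * R (t - s)) else 0)"
proof -
  have B0[measurable]: "B 0 \<in> borel_measurable M" by (rule random_variable) simp
  have "sojourn_time (with_drift B \<rho>) t =
    (\<lambda>\<omega>. \<integral>s. (if 0 \<le> s \<and> s \<le> t then indicator {0..} (drifted \<rho> s \<omega> + B 0 \<omega>) else 0) \<partial>lborel)"
    unfolding sojourn_time_def set_lebesgue_integral_def
    by (intro ext Bochner_Integration.integral_cong) (auto simp: with_drift_def drifted_def W_def split: split_indicator)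
  also have "\<dots> \<in> borel_measurable M" by measurable
  finally have [measurable]: "sojourn_time (with_drift B \<rho>) t \<in> borel_measurable M" .
  have "AE \<omega> in M. sojourn_time (with_drift B \<rho>) t \<omega> = sojourn_time (drifted \<rho>) t \<omega>"
    using start
  proof eventually_elim
    case (elim \<omega>)
    then show ?case
      unfolding sojourn_time_def by (intro set_lebesgue_integral_cong) (auto simp: with_drift_def drifted_def W_def)
  qed
  then have "distr M borel (sojourn_time (with_drift B \<rho>) t) = distr M borel (sojourn_time (drifted \<rho>) t)"
    by (intro distr_cong_AE) auto
  moreover have "distr M lborel (sojourn_time (with_drift B \<rho>) t) = distr M borel (sojourn_time (with_drift B \<rho>) t)"
    by (rule distr_cong) simp_all
  ultimately show ?thesis
    unfolding distributed_def distr by simp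
qed

end

text \<open>The constant \<open>1 / (2 * sqrt (2 * pi))\<close> makes the tail contribute half the
  Laplace exponent over \<kappa>; together with \<open>\<bar>\<rho>\<bar> / \<kappa>\<close> this
  reverses the sign of |\<rho>|. The result is the reciprocal of the Laplace exponent.\<close>

lemma laplace_drift_tail_affine:
  assumes "0 < \<kappa>"
  shows "(\<integral>\<^sup>+s. ennreal (indicator {0<..} s * (exp (- \<kappa> * s) * (\<bar>\<rho>\<bar> + 1 / (2 * sqrt (2 * pi)) * drift_tail \<rho> s))) \<partial>lborel)
    = ennreal ((sqrt (2 * \<kappa> + \<rho>\<^sup>2) + \<bar>\<rho>\<bar>) / (2 * \<kappa>))"
proof -
  let ?c = "1 / (2 * sqrt (2 * pi))"
  have "(\<integral>\<^sup>+s. ennreal (indicator {0<..} s * (exp (- \<kappa> * s) * (\<bar>\<rho>\<bar> + ?c * drift_tail \<rho> s))) \<partial>lborel)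
    = (\<integral>\<^sup>+s. ennreal \<bar>\<rho>\<bar> * ennreal (indicator {0<..} s * exp (- \<kappa> * s)) + ennreal ?c * ennreal (indicator {0<..} s * (exp (- \<kappa> * s) * drift_tail \<rho> s)) \<partial>lborel)"
  proof (rule nn_integral_cong)
    fix s :: real
    have "ennreal (exp (- \<kappa> * s) * (\<bar>\<rho>\<bar> + ?c * drift_tail \<rho> s)) = ennreal (\<bar>\<rho>\<bar> * exp (- \<kappa> * s) + ?c * (exp (- \<kappa> * s) * drift_tail \<rho> s))"
      by (simp add: algebra_simps)
    also have "\<dots> = ennreal (\<bar>\<rho>\<bar> * exp (- \<kappa> * s)) + ennreal (?c * (exp (- \<kappa> * s) * drift_tail \<rho> s))"
      by (rule ennreal_plus) (simp_all add: drift_tail_nonneg)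
    also have "\<dots> = ennreal \<bar>\<rho>\<bar> * ennreal (exp (- \<kappa> * s)) + ennreal ?c * ennreal (exp (- \<kappa> * s) * drift_tail \<rho> s)"
      by (intro arg_cong2[where f="(+)"] ennreal_mult') simp_all
    finally show "ennreal (indicator {0<..} s * (exp (- \<kappa> * s) * (\<bar>\<rho>\<bar> + ?c * drift_tail \<rho> s))) =
      ennreal \<bar>\<rho>\<bar> * ennreal (indicator {0<..} s * exp (- \<kappa> * s)) + ennreal ?c * ennreal (indicator {0<..} s * (exp (- \<kappa> * s) * drift_tail \<rho> s))"
      by (cases "0 < s") simp_all
  qed
  also have "\<dots> = (\<integral>\<^sup>+s. ennreal \<bar>\<rho>\<bar> * ennreal (indicator {0<..} s * exp (- \<kappa> * s)) \<partial>lborel) + (\<integral>\<^sup>+s. ennreal ?c * ennreal (indicator {0<..} s * (exp (- \<kappa> * s) * drift_tail \<rho> s)) \<partial>lborel)"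
    by (rule nn_integral_add) measurable
  also have "(\<integral>\<^sup>+s. ennreal \<bar>\<rho>\<bar> * ennreal (indicator {0<..} s * exp (- \<kappa> * s)) \<partial>lborel) = ennreal \<bar>\<rho>\<bar> * ennreal (1 / \<kappa>)"
    unfolding nn_integral_exp_greaterThan[OF assms, symmetric] by (rule nn_integral_cmult) measurable
  also have "(\<integral>\<^sup>+s. ennreal ?c * ennreal (indicator {0<..} s * (exp (- \<kappa> * s) * drift_tail \<rho> s)) \<partial>lborel) = ennreal ?c * ennreal (sqrt (2 * pi) * (sqrt (2 * \<kappa> + \<rho>\<^sup>2) - \<bar>\<rho>\<bar>) / \<kappa>)"
    unfolding laplace_drift_tail[OF assms, symmetric] by (rule nn_integral_cmult) measurable
  also have "ennreal \<bar>\<rho>\<bar> * ennreal (1 / \<kappa>) = ennreal (\<bar>\<rho>\<bar> * (1 / \<kappa>))"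
    by (rule ennreal_mult'[symmetric]) simp
  also have "ennreal ?c * ennreal (sqrt (2 * pi) * (sqrt (2 * \<kappa> + \<rho>\<^sup>2) - \<bar>\<rho>\<bar>) / \<kappa>) = ennreal (?c * (sqrt (2 * pi) * (sqrt (2 * \<kappa> + \<rho>\<^sup>2) - \<bar>\<rho>\<bar>) / \<kappa>))"
    by (rule ennreal_mult'[symmetric]) simp
  also have "ennreal (\<bar>\<rho>\<bar> * (1 / \<kappa>)) + ennreal (?c * (sqrt (2 * pi) * (sqrt (2 * \<kappa> + \<rho>\<^sup>2) - \<bar>\<rho>\<bar>) / \<kappa>)) =
      ennreal (\<bar>\<rho>\<bar> * (1 / \<kappa>) + ?c * (sqrt (2 * pi) * (sqrt (2 * \<kappa> + \<rho>\<^sup>2) - \<bar>\<rho>\<bar>) / \<kappa>))"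
  proof (rule ennreal_plus[symmetric])
    have "\<bar>\<rho>\<bar> \<le> sqrt (2 * \<kappa> + \<rho>\<^sup>2)" using assms by (intro real_le_rsqrt) simp
    then show "0 \<le> ?c * (sqrt (2 * pi) * (sqrt (2 * \<kappa> + \<rho>\<^sup>2) - \<bar>\<rho>\<bar>) / \<kappa>)" using assms by simp
  qed (use assms in simp)
  also have "\<bar>\<rho>\<bar> * (1 / \<kappa>) + ?c * (sqrt (2 * pi) * (sqrt (2 * \<kappa> + \<rho>\<^sup>2) - \<bar>\<rho>\<bar>) / \<kappa>) = (sqrt (2 * \<kappa> + \<rho>\<^sup>2) + \<bar>\<rho>\<bar>) / (2 * \<kappa>)"
    using assms by (simp add: field_simps)
  finally show ?thesis .
qed

lemma laplace_drift_tail_scaled: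
  assumes "0 < \<kappa>"
  shows "(\<integral>\<^sup>+s. ennreal (indicator {0<..} s * (exp (- \<kappa> * s) * (1 / sqrt (2 * pi) * drift_tail \<rho> s))) \<partial>lborel)
    = ennreal ((sqrt (2 * \<kappa> + \<rho>\<^sup>2) - \<bar>\<rho>\<bar>) / \<kappa>)"
proof -
  have "(\<integral>\<^sup>+s. ennreal (indicator {0<..} s * (exp (- \<kappa> * s) * (1 / sqrt (2 * pi) * drift_tail \<rho> s))) \<partial>lborel)
    = (\<integral>\<^sup>+s. ennreal (1 / sqrt (2 * pi)) * ennreal (indicator {0<..} s * (exp (- \<kappa> * s) * drift_tail \<rho> s)) \<partial>lborel)"
    by (intro nn_integral_cong) (auto simp: ennreal_mult[symmetric] drift_tail_nonneg split: split_indicator)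
  also have "\<dots> = ennreal (1 / sqrt (2 * pi)) * ennreal (sqrt (2 * pi) * (sqrt (2 * \<kappa> + \<rho>\<^sup>2) - \<bar>\<rho>\<bar>) / \<kappa>)"
    unfolding laplace_drift_tail[OF assms, symmetric] by (rule nn_integral_cmult) measurable
  also have "\<dots> = ennreal (1 / sqrt (2 * pi) * (sqrt (2 * pi) * (sqrt (2 * \<kappa> + \<rho>\<^sup>2) - \<bar>\<rho>\<bar>) / \<kappa>))"
    by (rule ennreal_mult'[symmetric]) simp
  finally show ?thesis by simp
qed

theorem theorem9p1:
  fixes M :: "'a measure" and B :: "real \<Rightarrow> 'a \<Rightarrow> real" and \<rho> t :: real
  assumes "brownian_motion M B"
    and "t > 0"
  shows "(\<rho> \<ge> 0 \<longrightarrow>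
      distributed M lborel (sojourn_time (with_drift B \<rho>) t)
        (\<lambda>s. if 0 < s \<and> s < t then ennreal
            (1 / sqrt (2 * pi)
              * (\<rho> + 1 / (2 * sqrt (2 * pi))
                    * (LBINT z:{s..}. exp (- \<rho>\<^sup>2 * z / 2) / z powr (3/2)))
              * (LBINT z:{t - s..}. exp (- \<rho>\<^sup>2 * z / 2) / z powr (3/2)))
          else 0)) \<and>
    (\<rho> \<le> 0 \<longrightarrow>
      distributed M lborel (sojourn_time (with_drift B \<rho>) t)
        (\<lambda>s. if 0 < s \<and> s < t then ennreal
            (1 / sqrt (2 * pi)
              * (\<bar>\<rho>\<bar> + 1 / (2 * sqrt (2 * pi))
                    * (LBINT z:{t - s..}. exp (- \<rho>\<^sup>2 * z / 2) / z powr (3/2)))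
              * (LBINT z:{s..}. exp (- \<rho>\<^sup>2 * z / 2) / z powr (3/2)))
          else 0))"
proof -
  interpret brownian_motion M B by fact
  define a where "a s = 1 / sqrt (2 * pi) * drift_tail \<rho> s" for s
  define b where "b s = \<bar>\<rho>\<bar> + 1 / (2 * sqrt (2 * pi)) * drift_tail \<rho> s" for s
  have meas: "a \<in> borel_measurable borel" "b \<in> borel_measurable borel"
    unfolding a_def b_def by measurable
  have nonneg: "0 \<le> a s" "0 \<le> b s" for s
    unfolding a_def b_def by (auto simp: drift_tail_nonneg intro!: add_nonneg_nonneg)
  have anti: "a t \<le> a s" "b t \<le> b s" if "0 < s" "s \<le> t" for s t
    unfolding a_def b_def using drift_tail_antimono[OF that, of \<rho>] by (auto intro!: divide_right_mono)
  have cont: "isCont a s" "isCont b s" if "0 < s" for s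
    unfolding a_def b_def by (intro continuous_intros isCont_drift_tail[OF that])+
  \<comment> \<open>Multiplying numerator and denominator by the conjugates removes the roots from
    the denominator and leaves exactly the two factors produced by the tail and the affine
    tail.\<close>
  have product: "(sqrt (2 * (\<kappa> + \<mu>) + \<rho>\<^sup>2) + \<rho>) * (sqrt (2 * \<kappa> + \<rho>\<^sup>2) - \<rho>) / (2 * (\<kappa> + \<mu>) * \<kappa>) =
      2 / ((sqrt (2 * (\<kappa> + \<mu>) + \<rho>\<^sup>2) - \<rho>) * (sqrt (2 * \<kappa> + \<rho>\<^sup>2) + \<rho>))"
    and ge: "\<bar>\<rho>\<bar> \<le> sqrt (2 * (\<kappa> + \<mu>) + \<rho>\<^sup>2)" "\<bar>\<rho>\<bar> \<le> sqrt (2 * \<kappa> + \<rho>\<^sup>2)"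
    if \<kappa>: "0 < \<kappa>" "0 \<le> \<mu>" for \<kappa> \<mu>
  proof -
    define \<delta> \<gamma> where "\<delta> = sqrt (2 * (\<kappa> + \<mu>) + \<rho>\<^sup>2)" and "\<gamma> = sqrt (2 * \<kappa> + \<rho>\<^sup>2)"
    have lt: "\<bar>\<rho>\<bar> < \<delta>" "\<bar>\<rho>\<bar> < \<gamma>" unfolding \<delta>_def \<gamma>_def using \<kappa> by (auto intro!: real_less_rsqrt)
    then show "\<bar>\<rho>\<bar> \<le> sqrt (2 * (\<kappa> + \<mu>) + \<rho>\<^sup>2)" "\<bar>\<rho>\<bar> \<le> sqrt (2 * \<kappa> + \<rho>\<^sup>2)"
      by (simp_all add: \<delta>_def \<gamma>_def)
    have sq: "\<delta>\<^sup>2 = 2 * (\<kappa> + \<mu>) + \<rho>\<^sup>2" "\<gamma>\<^sup>2 = 2 * \<kappa> + \<rho>\<^sup>2" using \<kappa> by (simp_all add: \<delta>_def \<gamma>_def)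
    have e: "2 * (\<kappa> + \<mu>) = (\<delta> - \<rho>) * (\<delta> + \<rho>)" "\<kappa> = (\<gamma> - \<rho>) * (\<gamma> + \<rho>) / 2"
      using sq by (simp_all add: power2_eq_square algebra_simps)
    have "(\<delta> + \<rho>) * (\<gamma> - \<rho>) / (2 * (\<kappa> + \<mu>) * \<kappa>) = 2 / ((\<delta> - \<rho>) * (\<gamma> + \<rho>))"
      unfolding e(1) using lt by (subst e(2)) (simp add: divide_simps, argo?)
    then show "(sqrt (2 * (\<kappa> + \<mu>) + \<rho>\<^sup>2) + \<rho>) * (sqrt (2 * \<kappa> + \<rho>\<^sup>2) - \<rho>) / (2 * (\<kappa> + \<mu>) * \<kappa>) =
      2 / ((sqrt (2 * (\<kappa> + \<mu>) + \<rho>\<^sup>2) - \<rho>) * (sqrt (2 * \<kappa> + \<rho>\<^sup>2) + \<rho>))"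
      unfolding \<delta>_def \<gamma>_def .
  qed
  \<comment> \<open>For \<rho> \<ge> 0 the factor in \<open>\<kappa> + \<mu>\<close> is a root plus
    |\<rho>|, so the affine tail \<open>b\<close> is attached to \<open>s\<close>. For \<rho> \<le>
    0 that factor becomes a root minus |\<rho>|, and \<open>a\<close> and \<open>b\<close> exchange
    their places.\<close>
  have "distributed M lborel (sojourn_time (with_drift B \<rho>) t) (\<lambda>s. if 0 < s \<and> s < t then ennreal (b s * a (t - s)) else 0)" if \<rho>: "0 \<le> \<rho>"
  proof (rule distributed_sojourn_with_drift[OF meas(2,1)], rule distr_sojourn[OF meas(2,1) nonneg(2,1) anti(2,1) cont(2,1)])
    fix \<kappa> \<mu> :: real assume \<kappa>: "0 < \<kappa>" "0 \<le> \<mu>"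
    then have \<kappa>\<mu>: "0 < \<kappa> + \<mu>" by simp
    show "(\<integral>\<^sup>+s. ennreal (indicator {0<..} s * (exp (- (\<kappa> + \<mu>) * s) * b s)) \<partial>lborel) * (\<integral>\<^sup>+s. ennreal (indicator {0<..} s * (exp (- \<kappa> * s) * a s)) \<partial>lborel)
      = ennreal (2 / ((sqrt (2 * (\<kappa> + \<mu>) + \<rho>\<^sup>2) - \<rho>) * (sqrt (2 * \<kappa> + \<rho>\<^sup>2) + \<rho>)))"
      unfolding a_def b_def laplace_drift_tail_affine[OF \<kappa>\<mu>] laplace_drift_tail_scaled[OF \<kappa>(1)] product[OF \<kappa>, symmetric]
      using \<kappa> \<rho> ge[OF \<kappa>] by (simp add: ennreal_mult[symmetric])
  qed (use assms in auto)
  moreover have "distributed M lborel (sojourn_time (with_drift B \<rho>) t) (\<lambda>s. if 0 < s \<and> s < t then ennreal (a s * b (t - s)) else 0)" if \<rho>: "\<rho> \<le> 0"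
  proof (rule distributed_sojourn_with_drift[OF meas], rule distr_sojourn[OF meas nonneg anti cont])
    fix \<kappa> \<mu> :: real assume \<kappa>: "0 < \<kappa>" "0 \<le> \<mu>"
    then have \<kappa>\<mu>: "0 < \<kappa> + \<mu>" by simp
    show "(\<integral>\<^sup>+s. ennreal (indicator {0<..} s * (exp (- (\<kappa> + \<mu>) * s) * a s)) \<partial>lborel) * (\<integral>\<^sup>+s. ennreal (indicator {0<..} s * (exp (- \<kappa> * s) * b s)) \<partial>lborel)
      = ennreal (2 / ((sqrt (2 * (\<kappa> + \<mu>) + \<rho>\<^sup>2) - \<rho>) * (sqrt (2 * \<kappa> + \<rho>\<^sup>2) + \<rho>)))"
      unfolding a_def b_def laplace_drift_tail_scaled[OF \<kappa>\<mu>] laplace_drift_tail_affine[OF \<kappa>(1)] product[OF \<kappa>, symmetric]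
      using \<kappa> \<rho> ge[OF \<kappa>] by (simp add: ennreal_mult[symmetric] mult.commute)
  qed (use assms in auto)
  moreover have "b s * a (t - s) = 1 / sqrt (2 * pi) * (\<bar>\<rho>\<bar> + 1 / (2 * sqrt (2 * pi)) * (LBINT z:{s..}. exp (- \<rho>\<^sup>2 * z / 2) / z powr (3/2)))
        * (LBINT z:{t - s..}. exp (- \<rho>\<^sup>2 * z / 2) / z powr (3/2))"
    "a s * b (t - s) = 1 / sqrt (2 * pi) * (\<bar>\<rho>\<bar> + 1 / (2 * sqrt (2 * pi)) * (LBINT z:{t - s..}. exp (- \<rho>\<^sup>2 * z / 2) / z powr (3/2)))
        * (LBINT z:{s..}. exp (- \<rho>\<^sup>2 * z / 2) / z powr (3/2))" for s
    unfolding a_def b_def drift_tail_def by (simp_all only: mult_ac)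
  ultimately show ?thesis by (simp only: abs_of_nonneg) blast
qed

end
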